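(* Let $n\ge 1$ be an integer. There exists $\epsilon>0$, depending only on $n$, such that the following holds. Let $\Lambda>0$, let ${\bf b}:\mathbb{R}^n\to\mathbb{R}^n$ and $q:\mathbb{R}^n\to\mathbb{R}$ satisfy $$\|q\|_{L^{\infty}(\mathbb{R}^{n})}+\|\nabla q\|_{L^{\infty}(\mathbb{R}^{n})}+\|\nabla{\bf b}\|_{L^{\infty}(\mathbb{R}^{n})}\le\Lambda \qquad\text{and}\qquad \|{\bf b}\|_{L^{\infty}(\mathbb{R}^{n})}\le\epsilon .$$ Let $u\in W^{2,p}(\mathbb{R}^{n})$, for some integer $p>n$, be a solution to $$(-\Delta)^{\frac{1}{2}}u+{\bf b}({\bf x})\cdot\nabla u+q({\bf x})u=0\quad\text{in }\mathbb{R}^{n}$$ such that, for some $\lambda>0$, $$|u({\bf x})|\le\Lambda e^{-\lambda|{\bf x}|}\quad\text{for all }{\bf x}\in\mathbb{R}^n .$$ Then $u\equiv0$.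
   Context: $(-\Delta)^{1/2}$ is the half-Laplacian on $\mathbb{R}^n$, i.e. the Fourier multiplier operator with symbol $|\xi|$. $\nabla$ is the (weak) gradient. $W^{2,p}(\mathbb{R}^n)$ is the usual $L^p$-based Sobolev space of order $2$. All functions are real-valued. *)

theory Defs
  imports "HOL-Analysis.Analysis" "HOL-Probability.Essential_Supremum"
begin

section \<open>Smooth functions, test functions and Schwartz functions\<close>

definition partial_deriv :: "'n::finite \<Rightarrow> (real^'n \<Rightarrow> 'b::real_normed_vector) \<Rightarrow> real^'n \<Rightarrow> 'b" where
  "partial_deriv i f x = frechet_derivative f (at x) (axis i 1)"

primrec partial_derivs :: "'n::finite list \<Rightarrow> (real^'n \<Rightarrow> 'b::real_normed_vector) \<Rightarrow> real^'n \<Rightarrow> 'b" where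
  "partial_derivs [] f = f"
| "partial_derivs (i # is) f = partial_deriv i (partial_derivs is f)"

text \<open>Differentiability of every iterated partial derivative makes all of them continuous, so this
  is the usual \<open>C\<^sup>\<infinity>\<close>; the underspecified \<^const>\<open>frechet_derivative\<close> is only ever taken of
  differentiable functions.\<close>
definition smooth :: "(real^'n::finite \<Rightarrow> 'b::real_normed_vector) \<Rightarrow> bool" where
  "smooth f \<longleftrightarrow> (\<forall>is x. partial_derivs is f differentiable (at x))"

definition test_function :: "(real^'n::finite \<Rightarrow> real) \<Rightarrow> bool" where
  "test_function \<phi> \<longleftrightarrow> smooth \<phi> \<and> compact (closure {x. \<phi> x \<noteq> 0})"

definition schwartz :: "(real^'n::finite \<Rightarrow> complex) \<Rightarrow> bool" where
  "schwartz \<phi> \<longleftrightarrow> smooth \<phi> \<and>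
     (\<forall>is k::nat. bounded (range (\<lambda>x. norm x ^ k *\<^sub>R partial_derivs is \<phi> x)))"

section \<open>Lebesgue and Sobolev spaces\<close>

definition Linf_norm :: "(real^'n::finite \<Rightarrow> 'b::real_normed_vector) \<Rightarrow> ereal" where
  "Linf_norm f = esssup lebesgue (\<lambda>x. ereal (norm (f x)))"

definition in_Lp :: "real \<Rightarrow> (real^'n::finite \<Rightarrow> 'b::real_normed_vector) \<Rightarrow> bool" where
  "in_Lp p f \<longleftrightarrow> f \<in> borel_measurable lebesgue \<and> integrable lebesgue (\<lambda>x. norm (f x) powr p)"

definition locally_integrable :: "(real^'n::finite \<Rightarrow> 'b::euclidean_space) \<Rightarrow> bool" where
  "locally_integrable f \<longleftrightarrow> (\<forall>K. compact K \<longrightarrow> f absolutely_integrable_on K)"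

definition has_weak_gradient :: "(real^'n::finite \<Rightarrow> real) \<Rightarrow> (real^'n \<Rightarrow> real^'n) \<Rightarrow> bool" where
  "has_weak_gradient u G \<longleftrightarrow> locally_integrable u \<and> locally_integrable G \<and>
     (\<forall>\<phi> i. test_function \<phi> \<longrightarrow>
        (LINT x|lebesgue. u x * partial_deriv i \<phi> x) = - (LINT x|lebesgue. G x $ i * \<phi> x))"

text \<open>Row \<open>i\<close> of the Jacobian is the weak gradient of the \<open>i\<close>-th component.\<close>
definition has_weak_jacobian ::
  "(real^'n::finite \<Rightarrow> real^'m::finite) \<Rightarrow> (real^'n \<Rightarrow> real^'n^'m) \<Rightarrow> bool" where
  "has_weak_jacobian b J \<longleftrightarrow> (\<forall>i. has_weak_gradient (\<lambda>x. b x $ i) (\<lambda>x. J x $ i))"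

primrec in_sobolev :: "nat \<Rightarrow> real \<Rightarrow> (real^'n::finite \<Rightarrow> real) \<Rightarrow> bool" where
  "in_sobolev 0 p u \<longleftrightarrow> in_Lp p u"
| "in_sobolev (Suc k) p u \<longleftrightarrow>
     in_Lp p u \<and> (\<exists>G. has_weak_gradient u G \<and> (\<forall>i. in_sobolev k p (\<lambda>x. G x $ i)))"

section \<open>The half-Laplacian\<close>

text \<open>With this normalisation \<open>- \<Delta>\<close> has symbol \<open>norm \<xi> ^ 2\<close>.\<close>
definition fourier :: "(real^'n::finite \<Rightarrow> complex) \<Rightarrow> real^'n \<Rightarrow> complex" where
  "fourier f \<xi> = (LINT x|lebesgue. exp (- \<i> * complex_of_real (x \<bullet> \<xi>)) * f x)"

text \<open>The function \<open>g\<close> is the image of \<open>u\<close> under the Fourier multiplier with symbol \<open>m\<close>, that is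
  \<open>F g = m F u\<close> in the sense of tempered distributions: by definition
  \<open>\<langle>F g, \<phi>\<rangle> = \<langle>g, F \<phi>\<rangle>\<close> and \<open>\<langle>m F u, \<phi>\<rangle> = \<langle>u, F (m \<phi>)\<rangle>\<close>. Testing on the Fourier side
  in this way is needed because \<open>F u\<close> need not be a function when \<open>u\<close> is in \<open>L\<^sup>p\<close> with \<open>p > 2\<close>.
  For \<open>m = norm\<close>, \<open>F (m \<phi>)\<close> is continuous and decays like \<open>norm x powr - (n + 1)\<close>, so both
  integrability requirements hold automatically for \<open>u\<close> and \<open>g\<close> in any \<open>L\<^sup>p\<close>, \<open>p \<ge> 1\<close>.\<close>
definition fourier_multiplier ::
  "(real^'n::finite \<Rightarrow> real) \<Rightarrow> (real^'n \<Rightarrow> real) \<Rightarrow> (real^'n \<Rightarrow> real) \<Rightarrow> bool" where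
  "fourier_multiplier m u g \<longleftrightarrow> (\<forall>\<phi>. schwartz \<phi> \<longrightarrow>
     integrable lebesgue (\<lambda>x. g x *\<^sub>R fourier \<phi> x) \<and>
     integrable lebesgue (\<lambda>x. u x *\<^sub>R fourier (\<lambda>\<xi>. m \<xi> *\<^sub>R \<phi> \<xi>) x) \<and>
     (LINT x|lebesgue. g x *\<^sub>R fourier \<phi> x) =
     (LINT x|lebesgue. u x *\<^sub>R fourier (\<lambda>\<xi>. m \<xi> *\<^sub>R \<phi> \<xi>) x))"

definition is_half_laplacian :: "(real^'n::finite \<Rightarrow> real) \<Rightarrow> (real^'n \<Rightarrow> real) \<Rightarrow> bool" where
  "is_half_laplacian u g \<longleftrightarrow> fourier_multiplier norm u g"

end

theory Submission
  imports Defs "HOL-Complex_Analysis.Conformal_Mappings" "HOL-Probability.Characteristic_Functions"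
    "HOL-Real_Asymp.Real_Asymp"
begin

text \<open>If \<open>u\<close> decays exponentially, then so does \<open>\<nabla>u\<close> in an integrated sense: on the
  annulus \<open>k \<le> \<bar>x\<bar> < k + 1\<close> compare \<open>\<partial>\<^sub>i u\<close> with the difference quotient of \<open>u\<close> with
  step \<open>t = exp (- \<lambda> k / 2)\<close>; the error is \<open>t\<close> times a local \<open>L\<^sup>1\<close> norm of \<open>\<partial>\<^sub>i \<partial>\<^sub>i u\<close>. By the
  equation, \<open>g = (- \<Delta>)\<^sup>1\<^sup>/\<^sup>2 u\<close> is then exponentially integrable as well, so along each line through
  the origin the Fourier transforms of \<open>u\<close> and \<open>g\<close> extend holomorphically to a strip, where they
  are related by \<open>\<F> g (t \<omega>) = \<bar>t\<bar> \<F> u (t \<omega>)\<close> for real \<open>t\<close> and unit vectors \<open>\<omega>\<close>. Since \<open>\<bar>t\<bar>\<close> is not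
  analytic at \<open>0\<close>, this forces \<open>\<F> u = 0\<close>.\<close>

section \<open>Smooth bump functions\<close>

text \<open>Decay is assumed for \<open>u\<close> alone, but the equation expresses
  \<open>Hu\<close> through the gradient too, so the gradient must be shown to decay before any
  transform can be continued. Second derivatives are known only to lie in \<open>L\<^sup>p\<close>;
  this is enough because their local integrals are absorbed by an arbitrarily weak exponential
  weight, and the strong decay of \<open>u\<close> leaves room for that loss. Everything is done
  with Borel representatives over \<open>lborel\<close>, where translation invariance and Fubini are
  available. Once \<open>u\<close> and \<open>Hu\<close> are known to be integrable, the multiplier
  relation, given only by pairing with test objects, becomes an identity of continuous functions.
  Passing between pairings and pointwise statements always goes through the fundamental lemma: it
  yields uniqueness of weak derivatives, the line formula for weak derivatives, the pointwise
  Fourier identity and injectivity of the Fourier transform. This is why the development begins with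
  explicit test functions.\<close>

definition bexp :: "nat \<Rightarrow> real \<Rightarrow> real" where
  "bexp m t = (if t > 0 then exp (- 1 / t) / t ^ m else 0)"

lemma bexp_le_1: "bexp 0 t \<le> 1" and bexp_nonneg: "bexp m t \<ge> 0"
  by (auto simp: bexp_def)

lemma bexp_tendsto_0: "(bexp m \<longlongrightarrow> 0) (at_right 0)"
proof -
  have "((\<lambda>t::real. (inverse t) ^ m / exp (inverse t)) \<longlongrightarrow> 0) (at_right 0)"
    by (rule filterlim_compose[OF tendsto_power_div_exp_0 filterlim_inverse_at_top_right])
  moreover have "\<forall>\<^sub>F t in at_right 0. (inverse t) ^ m / exp (inverse t) = bexp m t"
    using eventually_at_right_less[of 0]
    by eventually_elim (auto simp: bexp_def exp_minus field_simps)
  ultimately show ?thesis by (rule Lim_transform_eventually)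
qed

text \<open>Dividing by powers of t makes the family closed under differentiation: the exponential
  contributes the factor 1/t^2 and the power raises the index by one. At 0 only the right-hand
  difference quotient matters; it is \<open>bexp (Suc m) h\<close>, so \<open>bexp_tendsto_0\<close>
  gives derivative 0, in agreement with the formula, since every \<open>bexp\<close> vanishes
  there.\<close>

lemma has_real_derivative_bexp:
  "(bexp m has_real_derivative bexp (m + 2) t - real m * bexp (m + 1) t) (at t)"
proof -
  consider "t > 0" | "t < 0" | "t = 0" by linarith
  then show ?thesis
  proof cases
    case 1
    have "((\<lambda>t. exp (- 1 / t) / t ^ m) has_real_derivative
        (exp (- 1 / t) * (1 / t\<^sup>2) * t ^ m - exp (- 1 / t) * (real m * t ^ (m - 1))) / (t ^ m * t ^ m)) (at t)"
      using 1 by (auto intro!: derivative_eq_intros simp: power2_eq_square)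
    also have "(exp (- 1 / t) * (1 / t\<^sup>2) * t ^ m - exp (- 1 / t) * (real m * t ^ (m - 1))) / (t ^ m * t ^ m)
        = bexp (m + 2) t - real m * bexp (m + 1) t"
      using 1 by (cases m) (simp_all add: bexp_def diff_divide_distrib power_add power2_eq_square)
    finally have D: "((\<lambda>t. exp (- 1 / t) / t ^ m) has_real_derivative bexp (m + 2) t - real m * bexp (m + 1) t) (at t)" .
    have ev: "\<forall>\<^sub>F s in nhds t. exp (- 1 / s) / s ^ m = bexp m s"
      by (rule eventually_mono[OF eventually_nhds_in_open[of "{0<..}"]]) (use 1 in \<open>auto simp: bexp_def\<close>)
    show ?thesis using D by (rule DERIV_cong_ev[OF refl ev refl, THEN iffD1])
  next
    case 2
    have ev: "\<forall>\<^sub>F s in nhds t. 0 = bexp m s"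
      by (rule eventually_mono[OF eventually_nhds_in_open[of "{..<0}"]]) (use 2 in \<open>auto simp: bexp_def\<close>)
    have D: "((\<lambda>_. 0) has_real_derivative bexp (m + 2) t - real m * bexp (m + 1) t) (at t)"
      using 2 by (simp add: bexp_def)
    show ?thesis using D by (rule DERIV_cong_ev[OF refl ev refl, THEN iffD1])
  next
    case 3
    have "((\<lambda>h. bexp m h / h) \<longlongrightarrow> 0) (at 0)"
    proof (rule filterlim_split_at)
      have "\<forall>\<^sub>F h in at_left 0. 0 = bexp m h / h"
        by (auto simp: eventually_at_filter bexp_def)
      then show "((\<lambda>h. bexp m h / h) \<longlongrightarrow> 0) (at_left 0)"
        by (rule Lim_transform_eventually[OF tendsto_const])
      have "\<forall>\<^sub>F h in at_right 0. bexp (Suc m) h = bexp m h / h"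
        using eventually_at_right_less[of 0] by eventually_elim (auto simp: bexp_def)
      then show "((\<lambda>h. bexp m h / h) \<longlongrightarrow> 0) (at_right 0)"
        by (rule Lim_transform_eventually[OF bexp_tendsto_0])
    qed
    then show ?thesis using 3 by (simp add: bexp_def DERIV_def)
  qed
qed

text \<open>\<open>smooth\<close> quantifies over all iterated partial derivatives. Sums and
  products of constants and affine rescalings of \<open>bexp\<close> form a class stable under every
  partial derivative, so one induction on the list of indices settles all orders.\<close>

inductive bump_alg :: "(real^'n::finite \<Rightarrow> real) \<Rightarrow> bool" where
  bump_alg_const: "bump_alg (\<lambda>x. c)"
| bump_alg_bexp: "bump_alg (\<lambda>x. bexp m (c * x $ i + d))"
| bump_alg_add: "bump_alg f \<Longrightarrow> bump_alg g \<Longrightarrow> bump_alg (\<lambda>x. f x + g x)"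
| bump_alg_mult: "bump_alg f \<Longrightarrow> bump_alg g \<Longrightarrow> bump_alg (\<lambda>x. f x * g x)"

lemma bump_alg_prod: "finite I \<Longrightarrow> (\<And>i. i \<in> I \<Longrightarrow> bump_alg (f i)) \<Longrightarrow> bump_alg (\<lambda>x. \<Prod>i\<in>I. f i x)"
  by (induction I rule: finite_induct) (auto intro: bump_alg.intros)

lemma partial_deriv_eqI:
  assumes "(f has_derivative D) (at x)"
  shows "partial_deriv i f x = D (axis i 1)"
  using frechet_derivative_at[OF assms] by (simp add: partial_deriv_def)

lemma bump_alg_has_derivative:
  fixes f :: "real^'n::finite \<Rightarrow> real"
  assumes "bump_alg f"
  shows "\<exists>D. (\<forall>x. (f has_derivative D x) (at x)) \<and> (\<forall>i. bump_alg (\<lambda>x. D x (axis i 1)))"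
  using assms
proof induction
  case (bump_alg_const c)
  show ?case by (rule exI[of _ "\<lambda>x h. 0"]) (auto intro: bump_alg.intros)
next
  case (bump_alg_bexp m c j d)
  \<comment> \<open>The derivative is written as a sum with coefficient \<open>- real m\<close>, not
    as a difference, so that the closure rules of \<open>bump_alg\<close> apply.\<close>
  let ?E = "\<lambda>x::real^'n. bexp (m + 2) (c * x $ j + d) + (- real m) * bexp (m + 1) (c * x $ j + d)"
  have "((\<lambda>x. bexp m (c * x $ j + d)) has_derivative (\<lambda>h. (c * h $ j) * ?E x)) (at x)" for x :: "real^'n"
    by (rule has_derivative_compose[of "\<lambda>x. c * x $ j + d" "\<lambda>h. c * h $ j",
          OF _ has_real_derivative_bexp[unfolded has_field_derivative_def], THEN has_derivative_eq_rhs])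
       (auto intro!: derivative_eq_intros simp: algebra_simps bounded_linear.has_derivative[OF bounded_linear_vec_nth])
  moreover have "bump_alg (\<lambda>x::real^'n. (c * axis i 1 $ j) * ?E x)" for i
    by (intro bump_alg.intros)
  ultimately show ?case
    by (intro exI[of _ "\<lambda>x h. (c * h $ j) * ?E x"]) simp
next
  case (bump_alg_add f g)
  then obtain D E where "\<forall>x. (f has_derivative D x) (at x)" "\<forall>x. (g has_derivative E x) (at x)"
    "\<forall>i. bump_alg (\<lambda>x. D x (axis i 1))" "\<forall>i. bump_alg (\<lambda>x. E x (axis i 1))" by blast
  then show ?case
    by (intro exI[of _ "\<lambda>x h. D x h + E x h"]) (auto intro: bump_alg.intros has_derivative_add)
next
  case (bump_alg_mult f g)
  then obtain D E where "\<forall>x. (f has_derivative D x) (at x)" "\<forall>x. (g has_derivative E x) (at x)"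
    "\<forall>i. bump_alg (\<lambda>x. D x (axis i 1))" "\<forall>i. bump_alg (\<lambda>x. E x (axis i 1))" by blast
  with bump_alg_mult.hyps show ?case
    by (intro exI[of _ "\<lambda>x h. f x * E x h + D x h * g x"])
       (auto intro!: bump_alg.bump_alg_add bump_alg.bump_alg_mult has_derivative_mult)
qed

lemma bump_alg_partial_derivs: "bump_alg f \<Longrightarrow> bump_alg (partial_derivs is f)"
proof (induction "is")
  case (Cons i "is")
  then obtain D where "\<And>x. (partial_derivs is f has_derivative D x) (at x)" "bump_alg (\<lambda>x. D x (axis i 1))"
    using bump_alg_has_derivative[of "partial_derivs is f"] by auto
  moreover from this(1) have "partial_deriv i (partial_derivs is f) = (\<lambda>x. D x (axis i 1))"
    by (auto intro: partial_deriv_eqI)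
  ultimately show ?case by simp
qed auto

lemma bump_alg_smooth: "bump_alg f \<Longrightarrow> smooth f"
  unfolding smooth_def using bump_alg_partial_derivs bump_alg_has_derivative differentiable_def by blast

text \<open>For k > 0 and x in the box each factor is exp (-1 / (k s)), with s the distance of a
  coordinate to one of its bounds, so it tends to 1 as k grows. The arguments are spelled as
  \<open>c * x $ i + d\<close> to fit \<open>bump_alg_bexp\<close>.\<close>

definition box_bump :: "nat \<Rightarrow> real^'n::finite \<Rightarrow> real^'n \<Rightarrow> real^'n \<Rightarrow> real" where
  "box_bump k a b x =
     (\<Prod>i\<in>UNIV. bexp 0 (real k * x $ i + (- real k * a $ i)) * bexp 0 (- real k * x $ i + real k * b $ i))"

lemma box_bump_bounds: "0 \<le> box_bump k a b x" "box_bump k a b x \<le> 1"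
  unfolding box_bump_def
  by (auto intro!: prod_nonneg prod_le_1 mult_nonneg_nonneg mult_le_one bexp_nonneg bexp_le_1)

lemma box_bump_outside: "x \<notin> box a b \<Longrightarrow> box_bump k a b x = 0"
proof -
  assume "x \<notin> box a b"
  then obtain i where "x $ i \<le> a $ i \<or> b $ i \<le> x $ i"
    by (auto simp: box_vec_eq_empty mem_box_cart not_less)
  then have "bexp 0 (real k * x $ i + (- real k * a $ i)) * bexp 0 (- real k * x $ i + real k * b $ i) = 0"
    by (auto simp: bexp_def mult_less_cancel_left)
  then show ?thesis unfolding box_bump_def by (meson UNIV_I finite prod_zero)
qed

lemma test_function_box_bump: "test_function (box_bump k a b)"
proof -
  have "bump_alg (box_bump k a b)"
    unfolding box_bump_def by (intro bump_alg_prod bump_alg.intros finite)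
  moreover have "compact (closure {x. box_bump k a b x \<noteq> 0})"
  proof (rule compact_closure[THEN iffD2], rule bounded_subset[OF bounded_box[of a b]])
    show "{x. box_bump k a b x \<noteq> 0} \<subseteq> box a b" using box_bump_outside by blast
  qed
  ultimately show ?thesis by (simp add: test_function_def bump_alg_smooth)
qed

lemma box_bump_tendsto:
  fixes a b x :: "real^'n::finite"
  shows "(\<lambda>k. box_bump k a b x) \<longlonglongrightarrow> indicator (box a b) x"
proof (cases "x \<in> box a b")
  case True
  have *: "(\<lambda>k. bexp 0 (real k * s)) \<longlonglongrightarrow> 1" if "s > 0" for s
  proof -
    have "(\<lambda>k. exp (- 1 / (real k * s))) \<longlonglongrightarrow> 1" using that by real_asymp
    moreover have "\<forall>\<^sub>F k in sequentially. exp (- 1 / (real k * s)) = bexp 0 (real k * s)"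
      using eventually_gt_at_top[of 0] by eventually_elim (use that in \<open>auto simp: bexp_def\<close>)
    ultimately show ?thesis by (rule Lim_transform_eventually)
  qed
  have "(\<lambda>k. \<Prod>i\<in>UNIV. bexp 0 (real k * (x $ i - a $ i)) * bexp 0 (real k * (b $ i - x $ i))) \<longlonglongrightarrow> (\<Prod>i\<in>(UNIV::'n set). 1 * 1)"
    by (intro tendsto_prod tendsto_mult *) (use True in \<open>auto simp: mem_box_cart\<close>)
  then show ?thesis using True by (simp add: box_bump_def algebra_simps)
qed (simp add: box_bump_outside)

text \<open>Two uses share this form: \<open>L\<close> the identity gives translates of test
  functions, and \<open>a = 0\<close> with \<open>L\<close> the inclusion of the reals gives
  complex-valued ones.\<close>

lemma partial_derivs_comp:
  assumes L: "bounded_linear L" and \<phi>: "smooth \<phi>"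
  shows "partial_derivs is (\<lambda>x. L (\<phi> (x - a))) = (\<lambda>x. L (partial_derivs is \<phi> (x - a)))"
    and "(\<lambda>x. L (partial_derivs is \<phi> (x - a))) differentiable (at x)"
proof -
  have D: "((\<lambda>x. L (partial_derivs is \<phi> (x - a))) has_derivative
      (\<lambda>h. L (frechet_derivative (partial_derivs is \<phi>) (at (x - a)) h))) (at x)" for "is" x
  proof -
    have "(partial_derivs is \<phi> has_derivative frechet_derivative (partial_derivs is \<phi>) (at (x - a))) (at (x - a))"
      using \<phi> frechet_derivative_works unfolding smooth_def by blast
    moreover have "((\<lambda>x. x - a) has_derivative (\<lambda>h. h)) (at x)"
      by (auto intro!: derivative_eq_intros)
    ultimately show ?thesis
      using bounded_linear.has_derivative[OF L] has_derivative_compose by blast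
  qed
  then show "(\<lambda>x. L (partial_derivs is \<phi> (x - a))) differentiable (at x)"
    unfolding differentiable_def by blast
  show "partial_derivs is (\<lambda>x. L (\<phi> (x - a))) = (\<lambda>x. L (partial_derivs is \<phi> (x - a)))"
    by (induction "is") (auto simp: partial_deriv_def[of _ "partial_derivs _ \<phi>"] intro!: partial_deriv_eqI[OF D, THEN trans])
qed

lemma smooth_comp: "bounded_linear L \<Longrightarrow> smooth \<phi> \<Longrightarrow> smooth (\<lambda>x. L (\<phi> (x - a)))"
  unfolding smooth_def[of "\<lambda>x. L (\<phi> (x - a))"]
  by (subst partial_derivs_comp(1)) (auto intro: partial_derivs_comp(2))

section \<open>Translates, supports and bounds of test functions\<close>

lemma test_function_shift:
  assumes "test_function \<phi>"
  shows "test_function (\<lambda>x. \<phi> (x - a))" "partial_deriv i (\<lambda>x. \<phi> (x - a)) x = partial_deriv i \<phi> (x - a)"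
proof -
  have "bounded {x. \<phi> x \<noteq> 0}" using assms by (auto simp: test_function_def compact_closure)
  then have "bounded ((+) a ` {x. \<phi> x \<noteq> 0})" by (rule bounded_translation)
  moreover have "{x. \<phi> (x - a) \<noteq> 0} \<subseteq> (+) a ` {x. \<phi> x \<noteq> 0}"
    by (auto simp: image_iff intro!: exI[of _ "_ - a"])
  ultimately have "bounded {x. \<phi> (x - a) \<noteq> 0}" by (rule bounded_subset)
  then show "test_function (\<lambda>x. \<phi> (x - a))"
    using assms smooth_comp[OF bounded_linear_ident, of \<phi> a] by (auto simp: test_function_def compact_closure)
  show "partial_deriv i (\<lambda>x. \<phi> (x - a)) x = partial_deriv i \<phi> (x - a)"
    using partial_derivs_comp(1)[OF bounded_linear_ident, of \<phi> "[i]" a] assms by (auto simp: test_function_def dest: fun_cong)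
qed

lemma test_function_partial_derivs:
  assumes "test_function \<phi>"
  shows "continuous_on UNIV (partial_derivs is \<phi>)"
    and "{x. partial_derivs is \<phi> x \<noteq> 0} \<subseteq> closure {x. \<phi> x \<noteq> 0}"
proof -
  show c: "continuous_on UNIV (partial_derivs is \<phi>)" for "is"
    using assms unfolding test_function_def smooth_def
    by (meson continuous_at_imp_continuous_on differentiable_imp_continuous_within)
  show "{x. partial_derivs is \<phi> x \<noteq> 0} \<subseteq> closure {x. \<phi> x \<noteq> 0}"
  proof (induction "is")
    case (Cons i "is")
    let ?f = "partial_derivs is \<phi>"
    have "partial_deriv i ?f x = 0" if "x \<notin> closure {x. \<phi> x \<noteq> 0}" for x
    proof -
      have "(?f has_derivative (\<lambda>h. 0)) (at x)"
        by (rule has_derivative_transform_within_open[of "\<lambda>_. 0", where s = "- closure {x. \<phi> x \<noteq> 0}"])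
           (use Cons that in auto)
      then show ?thesis by (simp add: partial_deriv_eqI)
    qed
    then show ?case by auto
  qed (simp add: closure_subset)
qed

lemma test_function_continuous: "test_function \<phi> \<Longrightarrow> continuous_on UNIV \<phi>"
  using test_function_partial_derivs(1)[of \<phi> "[]"] by simp

lemma test_function_partial_deriv_continuous: "test_function \<phi> \<Longrightarrow> continuous_on UNIV (partial_deriv i \<phi>)"
  using test_function_partial_derivs(1)[of \<phi> "[i]"] by simp

lemma test_function_support:
  assumes "test_function \<phi>"
  obtains R where "R > 0" "\<And>x is. norm x > R \<Longrightarrow> partial_derivs is \<phi> x = 0"
proof -
  have "bounded (closure {x. \<phi> x \<noteq> 0})"
    using assms compact_imp_bounded unfolding test_function_def by blast
  then obtain R where R: "R > 0" "closure {x. \<phi> x \<noteq> 0} \<subseteq> cball 0 R"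
    by (meson ball_subset_cball bounded_subset_ballD subset_trans)
  have "partial_derivs is \<phi> x = 0" if "norm x > R" for x "is"
    using R(2) test_function_partial_derivs(2)[OF assms, of "is"] that by force
  with R(1) that show ?thesis by blast
qed

lemma bounded_continuous_compact_support:
  fixes f :: "'a::{heine_borel, real_normed_vector} \<Rightarrow> 'b::real_normed_vector"
  assumes "continuous_on UNIV f" "\<And>x. norm x > R \<Longrightarrow> f x = 0"
  shows "bounded (range f)"
proof -
  have "bounded (insert 0 (f ` cball 0 R))"
    using assms(1) by (auto intro!: compact_imp_bounded compact_continuous_image intro: continuous_on_subset)
  moreover have "range f \<subseteq> insert 0 (f ` cball 0 R)"
  proof
    fix y assume "y \<in> range f"
    then obtain x where "y = f x" by blast
    then show "y \<in> insert 0 (f ` cball 0 R)" using assms(2)[of x] by (cases "norm x > R") auto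
  qed
  ultimately show ?thesis by (rule bounded_subset)
qed

text \<open>Links the two kinds of testing: weak derivatives use real test functions, the Fourier
  multiplier complex Schwartz functions. The decay conditions hold because a continuous function
  with bounded support is bounded.\<close>

lemma schwartz_of_real_test_function:
  assumes "test_function \<phi>"
  shows "schwartz (\<lambda>x. complex_of_real (\<phi> x))"
proof -
  have \<phi>: "smooth \<phi>" using assms by (simp add: test_function_def)
  have D: "partial_derivs is (\<lambda>x. complex_of_real (\<phi> x)) = (\<lambda>x. complex_of_real (partial_derivs is \<phi> x))" for "is"
    using partial_derivs_comp(1)[OF bounded_linear_of_real \<phi>, of "is" 0] by simp
  obtain R where R: "\<And>x is. norm x > R \<Longrightarrow> partial_derivs is \<phi> x = 0"
    using test_function_support[OF assms] by metis
  have "bounded (range (\<lambda>x. norm x ^ k *\<^sub>R partial_derivs is (\<lambda>x. complex_of_real (\<phi> x)) x))" for "is" k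
    unfolding D
    by (rule bounded_continuous_compact_support[where R = R])
       (auto intro!: continuous_intros test_function_partial_derivs assms simp: R)
  then show ?thesis
    using smooth_comp[OF bounded_linear_of_real \<phi>, of 0] by (simp add: schwartz_def)
qed

section \<open>The fundamental lemma of the calculus of variations\<close>

lemma cball_borel [measurable]: "cball a r \<in> sets borel"
  by simp

lemma lborel_distr_plus': "distr lborel borel (\<lambda>x. x + c) = (lborel :: 'a::euclidean_space measure)"
proof -
  have "(\<lambda>x. x + c) = (+) c" by (auto simp: add.commute)
  then show ?thesis by (simp add: lborel_distr_plus)
qed

lemma lborel_integral_shift:
  fixes f :: "'a::euclidean_space \<Rightarrow> 'b::{banach, second_countable_topology}"
  assumes "f \<in> borel_measurable borel"
  shows "(LINT x|lborel. f (x + c)) = (LINT x|lborel. f x)"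
    and "integrable lborel (\<lambda>x. f (x + c)) \<longleftrightarrow> integrable lborel f"
proof -
  note d = lborel_distr_plus'[of c]
  show "(LINT x|lborel. f (x + c)) = (LINT x|lborel. f x)"
    using integral_distr[of "\<lambda>x. x + c" lborel borel f] assms by (simp add: d)
  show "integrable lborel (\<lambda>x. f (x + c)) \<longleftrightarrow> integrable lborel f"
    using integrable_distr_eq[of "\<lambda>x. x + c" lborel borel f] assms by (simp add: d)
qed

lemma lborel_nn_integral_shift:
  fixes f :: "'a::euclidean_space \<Rightarrow> ennreal"
  assumes "f \<in> borel_measurable borel"
  shows "(\<integral>\<^sup>+x. f (x + c) \<partial>lborel) = (\<integral>\<^sup>+x. f x \<partial>lborel)"
proof -
  note d = lborel_distr_plus'[of c]
  show ?thesis
    using nn_integral_distr[of "\<lambda>x. x + c" lborel borel f] assms by (simp add: d)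
qed

lemma lborel_AE_shift:
  fixes P :: "'a::euclidean_space \<Rightarrow> bool"
  assumes "AE x in lborel. P x"
  shows "AE x in lborel. P (x + c)"
proof -
  note d = lborel_distr_plus'[of c]
  show ?thesis
    by (rule AE_distrD[of "\<lambda>x. x + c" lborel borel]) (unfold d, use assms in auto)
qed

text \<open>Borel measurability is demanded so that \<open>f (x + s *\<^sub>R d)\<close> is jointly
  measurable in (s, x), as every exchange of integrals below requires.\<close>

definition loc_int :: "('a::euclidean_space \<Rightarrow> real) \<Rightarrow> bool" where
  "loc_int f \<longleftrightarrow> f \<in> borel_measurable borel \<and>
     (\<forall>R. integrable lborel (\<lambda>x. indicator (cball 0 R) x * f x))"

text \<open>One direction at a time: the decay argument compares u with its pure first and second
  derivatives in the same direction.\<close>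

definition weak_pd :: "'n::finite \<Rightarrow> (real^'n \<Rightarrow> real) \<Rightarrow> (real^'n \<Rightarrow> real) \<Rightarrow> bool" where
  "weak_pd i v w \<longleftrightarrow> loc_int v \<and> loc_int w \<and> (\<forall>\<phi>. test_function \<phi> \<longrightarrow>
     (LINT x|lborel. v x * partial_deriv i \<phi> x) = - (LINT x|lborel. w x * \<phi> x))"

lemma loc_int_measurable [measurable_dest]: "loc_int f \<Longrightarrow> f \<in> borel_measurable borel"
  by (simp add: loc_int_def)

lemma loc_int_diff: "loc_int f \<Longrightarrow> loc_int g \<Longrightarrow> loc_int (\<lambda>x. f x - g x)"
  by (auto simp: loc_int_def right_diff_distrib)

lemma loc_int_nn_integral:
  assumes "loc_int f"
  shows "(\<integral>\<^sup>+x. indicator (cball 0 R) x * ennreal \<bar>f x\<bar> \<partial>lborel) < \<infinity>"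
proof -
  have "integrable lborel (\<lambda>x. indicator (cball 0 R) x * f x)" using assms by (simp add: loc_int_def)
  then have "(\<integral>\<^sup>+x. ennreal (norm (indicator (cball 0 R) x * f x)) \<partial>lborel) < \<infinity>"
    by (simp add: integrable_iff_bounded)
  also have "(\<lambda>x. ennreal (norm (indicator (cball 0 R) x * f x))) = (\<lambda>x. indicator (cball 0 R) x * ennreal \<bar>f x\<bar>)"
    by (auto simp: indicator_def)
  finally show ?thesis .
qed

lemma loc_int_shift:
  assumes "loc_int f"
  shows "loc_int (\<lambda>x. f (x + c))"
proof -
  have [measurable]: "f \<in> borel_measurable borel" using assms by measurable
  have "integrable lborel (\<lambda>x. indicator (cball 0 R) x * f (x + c))" for R
  proof -
    have m: "(\<lambda>x. indicator (cball 0 (R + norm c)) x * f x) \<in> borel_measurable borel"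
      by measurable
    have "integrable lborel (\<lambda>x. indicator (cball 0 (R + norm c)) (x + c) * f (x + c))"
      using assms lborel_integral_shift(2)[OF m] by (simp add: loc_int_def)
    then show ?thesis
    proof (rule Bochner_Integration.integrable_bound)
      show "AE x in lborel. norm (indicator (cball 0 R) x * f (x + c))
          \<le> norm (indicator (cball 0 (R + norm c)) (x + c) * f (x + c))"
      proof (rule AE_I2)
        fix x
        have "norm (x + c) \<le> norm x + norm c" by (rule norm_triangle_ineq)
        then show "norm (indicator (cball 0 R) x * f (x + c))
          \<le> norm (indicator (cball 0 (R + norm c)) (x + c) * f (x + c))"
          by (auto simp: indicator_def)
      qed
    qed measurable
  qed
  then show ?thesis by (simp add: loc_int_def)
qed

section \<open>Pairing locally integrable functions with test functions\<close>

lemma loc_int_mult_integrable: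
  assumes "loc_int f" and [measurable]: "\<psi> \<in> borel_measurable borel"
    and "\<And>x. \<bar>\<psi> x\<bar> \<le> B" "\<And>x. norm x > R \<Longrightarrow> \<psi> x = 0"
  shows "integrable lborel (\<lambda>x. f x * \<psi> x)"
proof -
  have [measurable]: "f \<in> borel_measurable borel" using assms(1) by measurable
  show ?thesis
  proof (rule Bochner_Integration.integrable_bound)
    show "integrable lborel (\<lambda>x. B * (indicator (cball 0 R) x * f x))"
      using assms(1) by (simp add: loc_int_def)
    show "AE x in lborel. norm (f x * \<psi> x) \<le> norm (B * (indicator (cball 0 R) x * f x))"
    proof (rule AE_I2)
      fix x
      have "\<bar>f x\<bar> * \<bar>\<psi> x\<bar> \<le> \<bar>f x\<bar> * \<bar>B\<bar>" using assms(3)[of x] by (intro mult_left_mono) auto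
      then show "norm (f x * \<psi> x) \<le> norm (B * (indicator (cball 0 R) x * f x))"
        using assms(4)[of x] by (cases "norm x > R") (auto simp: abs_mult mult.commute)
    qed
  qed measurable
qed

lemma test_function_bounded:
  assumes "test_function \<phi>"
  obtains B R where "\<And>x. \<bar>\<phi> x\<bar> \<le> B" "\<And>x. \<bar>partial_deriv i \<phi> x\<bar> \<le> B" "R > 0"
    "\<And>x. norm x > R \<Longrightarrow> \<phi> x = 0" "\<And>x. norm x > R \<Longrightarrow> partial_deriv i \<phi> x = 0"
proof -
  obtain R where R: "R > 0" "\<And>x is. norm x > R \<Longrightarrow> partial_derivs is \<phi> x = 0"
    using test_function_support[OF assms] by metis
  have b: "bounded (range (partial_derivs is \<phi>))" for "is"
    by (rule bounded_continuous_compact_support[OF test_function_partial_derivs(1)[OF assms] R(2)])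
  obtain B0 where "\<And>x. \<bar>\<phi> x\<bar> \<le> B0" using b[of "[]"] unfolding bounded_iff by auto
  moreover obtain B1 where "\<And>x. \<bar>partial_deriv i \<phi> x\<bar> \<le> B1" using b[of "[i]"] unfolding bounded_iff by auto
  moreover have "norm x > R \<Longrightarrow> \<phi> x = 0" "norm x > R \<Longrightarrow> partial_deriv i \<phi> x = 0" for x
    using R(2)[of x "[]"] R(2)[of x "[i]"] by auto
  ultimately show ?thesis using R(1)
    by (intro that[of "max B0 B1" R]) (auto simp: le_max_iff_disj)
qed

lemma test_function_measurable:
  assumes "test_function \<phi>"
  shows "\<phi> \<in> borel_measurable borel" "partial_deriv i \<phi> \<in> borel_measurable borel"
  using assms
  by (auto intro: borel_measurable_continuous_onI test_function_continuous test_function_partial_deriv_continuous)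

lemma loc_int_test_integrable:
  assumes "loc_int f" "test_function \<phi>"
  shows "integrable lborel (\<lambda>x. f x * \<phi> x)" "integrable lborel (\<lambda>x. f x * partial_deriv i \<phi> x)"
proof -
  obtain B R where "\<And>x. \<bar>\<phi> x\<bar> \<le> B" "\<And>x. \<bar>partial_deriv i \<phi> x\<bar> \<le> B"
    "\<And>x. norm x > R \<Longrightarrow> \<phi> x = 0" "\<And>x. norm x > R \<Longrightarrow> partial_deriv i \<phi> x = 0"
    using test_function_bounded[OF assms(2)] by metis
  then show "integrable lborel (\<lambda>x. f x * \<phi> x)" "integrable lborel (\<lambda>x. f x * partial_deriv i \<phi> x)"
    by (auto intro!: loc_int_mult_integrable assms test_function_measurable)
qed

lemma continuous_imp_loc_int:
  assumes "continuous_on UNIV f"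
  shows "loc_int f"
  unfolding loc_int_def
  using borel_integrable_compact[of "cball 0 _" f] assms
  by (auto intro: borel_measurable_continuous_onI continuous_on_subset)

lemma test_function_integrable:
  assumes "test_function \<phi>"
  shows "integrable lborel \<phi>"
  using loc_int_test_integrable(1)[OF continuous_imp_loc_int assms, of "\<lambda>_. 1"] by simp

text \<open>Box bumps are bounded by 1 and converge to the indicator of the box, so dominated
  convergence makes every integral of f over a box vanish. Boxes are stable under intersection and
  generate the Borel sets; Dynkin's argument extends this to all Borel subsets of a box, which
  forces f to vanish almost everywhere there.\<close>

lemma fundamental_lemma:
  fixes f :: "real^'n::finite \<Rightarrow> real"
  assumes f: "loc_int f" and zero: "\<And>\<phi>. test_function \<phi> \<Longrightarrow> (LINT x|lborel. f x * \<phi> x) = 0"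
  shows "AE x in lborel. f x = 0"
proof -
  have [measurable]: "f \<in> borel_measurable borel" using f by measurable
  have box: "(LINT x|lborel. f x * indicator (box a b) x) = 0" for a b
  proof -
    obtain R where R: "box a b \<subseteq> cball 0 R"
      using bounded_box[of a b] by (meson bounded_iff mem_cball_0 subsetI)
    have "(\<lambda>k. LINT x|lborel. f x * box_bump k a b x) \<longlonglongrightarrow> (LINT x|lborel. f x * indicator (box a b) x)"
    proof (rule integral_dominated_convergence)
      show "integrable lborel (\<lambda>x. \<bar>indicator (cball 0 R) x * f x\<bar>)"
        using f by (auto simp: loc_int_def)
      show "AE x in lborel. norm (f x * box_bump k a b x) \<le> \<bar>indicator (cball 0 R) x * f x\<bar>" for k
      proof (rule AE_I2)
        fix x
        have "norm (f x * box_bump k a b x) \<le> \<bar>f x\<bar>" 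
          using box_bump_bounds[of k a b x] by (simp add: abs_mult mult_left_le)
        then show "norm (f x * box_bump k a b x) \<le> \<bar>indicator (cball 0 R) x * f x\<bar>"
          using R box_bump_outside[of x a b k] by (cases "x \<in> box a b") (auto simp: indicator_def)
      qed
      show "(\<lambda>x. f x * box_bump k a b x) \<in> borel_measurable lborel" for k
        using test_function_measurable(1)[OF test_function_box_bump[of k a b]] by measurable
    qed (auto intro!: tendsto_intros box_bump_tendsto)
    then show ?thesis
      by (simp add: zero test_function_box_bump LIMSEQ_const_iff)
  qed
  \<comment> \<open>Cutting f off to a box makes it integrable; the complement step of the induction
    subtracts from the total integral, which must therefore be finite.\<close>
  have gz: "AE x in lborel. f x * indicator (box a b) x = 0" (is "AE x in lborel. ?g x = 0") for a b
  proof (rule sigma_finite_measure.density_zero[OF lborel.sigma_finite_measure_axioms])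
    obtain R where R: "box a b \<subseteq> cball 0 R"
      using bounded_box[of a b] by (meson bounded_iff mem_cball_0 subsetI)
    show g: "integrable lborel ?g"
      by (rule loc_int_mult_integrable[OF f, where B = 1 and R = R])
         (use R in \<open>auto simp: indicator_def\<close>)
    have gA: "set_integrable lborel A ?g" if "A \<in> sets borel" for A
      unfolding set_integrable_def using g that by (intro integrable_mult_indicator) auto
    fix A :: "(real^'n) set" assume "A \<in> sets lborel"
    then have A: "A \<in> sigma_sets UNIV (range (\<lambda>(a, b). box a b))"
      by (simp add: borel_eq_box)
    have Int: "Int_stable (range (\<lambda>(a, b). box a b :: (real^'n) set))"
      by (auto simp: Int_stable_def box_Int_box)
    have sub: "range (\<lambda>(a, b). box a b :: (real^'n) set) \<subseteq> Pow UNIV" by simp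
    from Int sub A show "set_lebesgue_integral lborel A ?g = 0"
    proof (induction rule: sigma_sets_induct_disjoint)
      case (basic A)
      then obtain c d where A: "A = box c d" by auto
      obtain c' d' where "box c d \<inter> box a b = box c' d'" by (simp add: box_Int_box)
      then have "(\<lambda>x. indicator A x *\<^sub>R ?g x) = (\<lambda>x. f x * indicator (box c' d') x)"
        unfolding A by (auto simp: indicator_def fun_eq_iff)
      then show ?case unfolding set_lebesgue_integral_def by (simp only: box)
    next
      case (compl A)
      then have [measurable]: "A \<in> sets borel" by (simp add: borel_eq_box)
      have "set_lebesgue_integral lborel (UNIV - A) ?g = (LINT x|lborel. ?g x - indicator A x *\<^sub>R ?g x)"
        unfolding set_lebesgue_integral_def by (intro Bochner_Integration.integral_cong) (auto simp: indicator_def)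
      also have "\<dots> = (LINT x|lborel. ?g x) - set_lebesgue_integral lborel A ?g"
        unfolding set_lebesgue_integral_def using g gA[of A]
        by (intro Bochner_Integration.integral_diff) (auto simp: set_integrable_def)
      finally show ?case using compl by (simp add: box)
    next
      case (union A)
      then have [measurable]: "A i \<in> sets borel" for i by (auto simp: borel_eq_box)
      have "set_lebesgue_integral lborel (\<Union>i. A i) ?g = (\<Sum>i. set_lebesgue_integral lborel (A i) ?g)"
        using union gA[of "\<Union>i. A i"] by (intro lebesgue_integral_countable_add) (auto simp: disjoint_family_on_def)
      then show ?case using union by simp
    qed (simp add: set_lebesgue_integral_def)
  qed
  have "AE x in lborel. \<forall>n. f x * indicator (box (- (real n *\<^sub>R One)) (real n *\<^sub>R One)) x = 0"
    unfolding AE_all_countable using gz by blast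
  then show ?thesis
  proof eventually_elim
    case (elim x)
    obtain n :: nat where "x \<in> box (- (real n *\<^sub>R One)) (real n *\<^sub>R One)" using UN_box_eq_UNIV by blast
    with elim[rule_format, of n] show ?case by simp
  qed
qed

text \<open>Needed because the gradient in the equation and the one supplied by the Sobolev
  condition are separate objects; it identifies them almost everywhere, also after a change of
  representative.\<close>

lemma weak_pd_unique:
  fixes v :: "real^'n::finite \<Rightarrow> real"
  assumes "weak_pd i v w" "weak_pd i v' w'" "AE x in lborel. v x = v' x"
  shows "AE x in lborel. w x = w' x"
proof -
  have "AE x in lborel. w x - w' x = 0"
  proof (rule fundamental_lemma)
    show "loc_int (\<lambda>x. w x - w' x)" using assms by (auto simp: weak_pd_def intro: loc_int_diff)
    fix \<phi> :: "real^'n \<Rightarrow> real" assume \<phi>: "test_function \<phi>"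
    have [measurable]: "v \<in> borel_measurable borel" "v' \<in> borel_measurable borel" "partial_deriv i \<phi> \<in> borel_measurable borel"
      using assms test_function_measurable[OF \<phi>] by (auto simp: weak_pd_def loc_int_measurable)
    have "(LINT x|lborel. v x * partial_deriv i \<phi> x) = (LINT x|lborel. v' x * partial_deriv i \<phi> x)"
      using assms(3) by (intro integral_cong_AE) auto
    then have "(LINT x|lborel. w x * \<phi> x) = (LINT x|lborel. w' x * \<phi> x)"
      using assms(1,2) \<phi> by (simp add: weak_pd_def)
    then show "(LINT x|lborel. (w x - w' x) * \<phi> x) = 0"
      using assms \<phi> by (simp add: weak_pd_def left_diff_distrib loc_int_test_integrable)
  qed
  then show ?thesis by eventually_elim simp
qed

text \<open>The integrability condition behind the Fubini exchanges on lines. For each s in {0..t}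
  the shift moves the ball of radius R into one fixed larger ball, so by translation invariance all
  slices have a common bound. Taking \<open>d = 0\<close> covers the case where the shift sits in
  the kernel.\<close>

lemma loc_int_pair_integrable:
  fixes w :: "'a::euclidean_space \<Rightarrow> real"
  assumes w: "loc_int w" and k[measurable]: "case_prod k \<in> borel_measurable (borel \<Otimes>\<^sub>M borel)"
    and B: "\<And>s x. \<bar>k s x\<bar> \<le> B" and supp: "\<And>s x. s \<notin> {0..t} \<or> norm x > R \<Longrightarrow> k s x = 0"
  shows "integrable (lborel \<Otimes>\<^sub>M lborel) (\<lambda>(s::real, x). w (x + s *\<^sub>R d) * k s x)"
proof (rule integrableI_bounded)
  have [measurable]: "w \<in> borel_measurable borel" using w by measurable
  show [measurable]: "(\<lambda>(s::real, x). w (x + s *\<^sub>R d) * k s x) \<in> borel_measurable (lborel \<Otimes>\<^sub>M lborel)"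
    by measurable
  define C where "C = (\<integral>\<^sup>+x. indicator (cball 0 (R + \<bar>t\<bar> * norm d)) x * ennreal \<bar>w x\<bar> \<partial>lborel)"
  have "B \<ge> 0" using B[of 0 0] by linarith
  have "(\<integral>\<^sup>+z. ennreal (norm (case z of (s, x) \<Rightarrow> w (x + s *\<^sub>R d) * k s x)) \<partial>(lborel \<Otimes>\<^sub>M lborel))
    = (\<integral>\<^sup>+s. \<integral>\<^sup>+x. ennreal (norm (w (x + s *\<^sub>R d) * k s x)) \<partial>lborel \<partial>lborel)"
    by (subst lborel.nn_integral_fst[symmetric]) auto
  also have "\<dots> \<le> (\<integral>\<^sup>+s. ennreal B * C * indicator {0..t} s \<partial>lborel)"
  proof (rule nn_integral_mono)
    fix s :: real
    show "(\<integral>\<^sup>+x. ennreal (norm (w (x + s *\<^sub>R d) * k s x)) \<partial>lborel) \<le> ennreal B * C * indicator {0..t} s"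
    proof (cases "s \<in> {0..t}")
      case True
      have "(\<integral>\<^sup>+x. ennreal (norm (w (x + s *\<^sub>R d) * k s x)) \<partial>lborel)
        \<le> (\<integral>\<^sup>+x. ennreal B * (indicator (cball 0 (R + \<bar>t\<bar> * norm d)) (x + s *\<^sub>R d) * ennreal \<bar>w (x + s *\<^sub>R d)\<bar>) \<partial>lborel)"
      proof (rule nn_integral_mono)
        fix x
        have "norm (x + s *\<^sub>R d) \<le> norm x + \<bar>s\<bar> * norm d" by (metis norm_scaleR norm_triangle_ineq)
        also have "\<dots> \<le> norm x + \<bar>t\<bar> * norm d" using True by (intro add_left_mono mult_right_mono) auto
        finally have "norm x \<le> R \<Longrightarrow> x + s *\<^sub>R d \<in> cball 0 (R + \<bar>t\<bar> * norm d)" by simp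
        moreover have "\<bar>w (x + s *\<^sub>R d)\<bar> * \<bar>k s x\<bar> \<le> \<bar>w (x + s *\<^sub>R d)\<bar> * B"
          using B by (intro mult_left_mono) auto
        ultimately show "ennreal (norm (w (x + s *\<^sub>R d) * k s x))
            \<le> ennreal B * (indicator (cball 0 (R + \<bar>t\<bar> * norm d)) (x + s *\<^sub>R d) * ennreal \<bar>w (x + s *\<^sub>R d)\<bar>)"
          using \<open>B \<ge> 0\<close> supp[of s x] 
          by (cases "norm x > R") (auto simp: abs_mult ennreal_mult'[symmetric] mult.commute intro!: ennreal_leI)
      qed
      also have "\<dots> = ennreal B * C" unfolding C_def
        by (subst lborel_nn_integral_shift[of "\<lambda>x. ennreal B * (indicator (cball 0 (R + \<bar>t\<bar> * norm d)) x * ennreal \<bar>w x\<bar>)"])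
           (measurable, rule nn_integral_cmult, measurable)
      finally show ?thesis using True by simp
    qed (use supp[of s] in simp)
  qed
  also have "\<dots> = ennreal B * C * ennreal (max 0 t)"
    by (subst nn_integral_cmult_indicator) (auto simp: emeasure_lborel_Icc_eq max_def)
  also have "\<dots> < \<infinity>" unfolding C_def
    using loc_int_nn_integral[OF w] by (simp add: ennreal_mult_less_top)
  finally show "(\<integral>\<^sup>+z. ennreal (norm (case z of (s, x) \<Rightarrow> w (x + s *\<^sub>R d) * k s x)) \<partial>(lborel \<Otimes>\<^sub>M lborel)) < \<infinity>" .
qed

section \<open>Weak derivatives on lines\<close>

text \<open>The junk value 0 of the integral makes integrability unnecessary.\<close>
lemma abs_integral_le_nn_integral:
  fixes f :: "'a \<Rightarrow> real"
  shows "ennreal \<bar>LINT x|M. f x\<bar> \<le> (\<integral>\<^sup>+x. ennreal \<bar>f x\<bar> \<partial>M)"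
  using integral_norm_bound_ennreal[of M f]
  by (cases "integrable M f") (auto simp: not_integrable_integral_eq)

lemma test_function_line_integral:
  fixes \<phi> :: "real^'n::finite \<Rightarrow> real"
  assumes \<phi>: "test_function \<phi>" and "t \<ge> 0"
  shows "(LINT s|lborel. indicator {0..t} s * partial_deriv i \<phi> (x - s *\<^sub>R axis i 1)) = \<phi> x - \<phi> (x - t *\<^sub>R axis i 1)"
proof -
  have D: "((\<lambda>s. - \<phi> (x - s *\<^sub>R axis i 1)) has_vector_derivative partial_deriv i \<phi> (x - s *\<^sub>R axis i 1)) (at s within {0..t})" for s
  proof -
    have "partial_derivs [] \<phi> differentiable at (x - s *\<^sub>R axis i 1)"
      using \<phi> unfolding test_function_def smooth_def by blast
    then have d: "(\<phi> has_derivative frechet_derivative \<phi> (at (x - s *\<^sub>R axis i 1))) (at (x - s *\<^sub>R axis i 1))" (is "(_ has_derivative ?D) _")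
      by (simp add: frechet_derivative_works)
    have "((\<lambda>s. \<phi> (x - s *\<^sub>R axis i 1)) has_derivative (\<lambda>h. ?D (- h *\<^sub>R axis i 1))) (at s)"
      by (rule has_derivative_compose[where f = "\<lambda>s. x - s *\<^sub>R axis i 1" and g = \<phi>, OF _ d])
         (auto intro!: derivative_eq_intros)
    then have "((\<lambda>s. - \<phi> (x - s *\<^sub>R axis i 1)) has_derivative (\<lambda>h. - ?D (- h *\<^sub>R axis i 1))) (at s)"
      by (rule has_derivative_minus)
    also have "(\<lambda>h. - ?D (- h *\<^sub>R axis i 1)) = (\<lambda>h. h *\<^sub>R partial_deriv i \<phi> (x - s *\<^sub>R axis i 1))"
      using has_derivative_linear[OF d] by (auto simp: partial_deriv_def linear_neg linear_scale)
    finally show ?thesis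
      unfolding has_vector_derivative_def by (rule has_derivative_at_withinI)
  qed
  have "(LINT s|lborel. indicator {0..t} s *\<^sub>R partial_deriv i \<phi> (x - s *\<^sub>R axis i 1))
      = - \<phi> (x - t *\<^sub>R axis i 1) - (- \<phi> (x - 0 *\<^sub>R axis i 1))"
    by (rule integral_FTC_Icc)
       (use \<open>t \<ge> 0\<close> D in \<open>auto intro!: continuous_intros continuous_on_compose2[OF test_function_partial_deriv_continuous[OF \<phi>]]\<close>)
  then show ?thesis by simp
qed

text \<open>Tested against \<phi>, the shift in w moves to \<phi>, the weak derivative moves to
  \<phi>, and what remains is the classical fundamental theorem for \<phi> along a line. No
  absolutely continuous representative is constructed; the exceptional null set may depend on
  t.\<close>

lemma weak_pd_ftc:
  fixes v :: "real^'n::finite \<Rightarrow> real"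
  assumes vw: "weak_pd i v w" and "t \<ge> 0"
  shows "AE x in lborel. v (x + t *\<^sub>R axis i 1) - v x
    = (LINT s|lborel. indicator {0..t} s * w (x + s *\<^sub>R axis i 1))"
proof -
  let ?e = "axis i 1 :: real^'n"
  define W where "W x = (LINT s|lborel. indicator {0..t} s * w (x + s *\<^sub>R ?e))" for x
  have v: "loc_int v" and w: "loc_int w" using vw by (auto simp: weak_pd_def)
  have [measurable]: "v \<in> borel_measurable borel" "w \<in> borel_measurable borel"
    using v w by measurable
  have [measurable]: "W \<in> borel_measurable borel" unfolding W_def by measurable
  have W: "loc_int W"
  proof -
    have "integrable lborel (\<lambda>x. indicator (cball 0 R) x * W x)" for R
    proof -
      have "integrable (lborel \<Otimes>\<^sub>M lborel) (\<lambda>(s, x). w (x + s *\<^sub>R ?e) * (indicator {0..t} s * indicator (cball 0 R) x))"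
        by (rule loc_int_pair_integrable[OF w, where B = 1 and t = t and R = R]) (auto simp: indicator_def)
      from lborel_pair.integrable_snd[OF this]
      show ?thesis unfolding W_def by (subst integral_mult_right_zero[symmetric]) (simp add: mult_ac)
    qed
    then show ?thesis by (simp add: loc_int_def)
  qed
  have "AE x in lborel. (v (x + t *\<^sub>R ?e) - v x) - W x = 0"
  proof (rule fundamental_lemma)
    show "loc_int (\<lambda>x. (v (x + t *\<^sub>R ?e) - v x) - W x)"
      by (intro loc_int_diff loc_int_shift v W)
    fix \<phi> :: "real^'n \<Rightarrow> real" assume \<phi>: "test_function \<phi>"
    obtain B R where BR: "\<And>x. \<bar>\<phi> x\<bar> \<le> B" "\<And>x. \<bar>partial_deriv i \<phi> x\<bar> \<le> B" "R > 0"
      "\<And>x. norm x > R \<Longrightarrow> \<phi> x = 0" "\<And>x. norm x > R \<Longrightarrow> partial_deriv i \<phi> x = 0"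
      using test_function_bounded[OF \<phi>] by metis
    note [measurable] = test_function_measurable[OF \<phi>]
    have "(LINT x|lborel. W x * \<phi> x) = (LINT x|lborel. LINT s|lborel. w (x + s *\<^sub>R ?e) * (indicator {0..t} s * \<phi> x))"
      unfolding W_def by (subst integral_mult_left_zero[symmetric]) (simp add: mult_ac)
    also have "\<dots> = (LINT s|lborel. LINT x|lborel. w (x + s *\<^sub>R ?e) * (indicator {0..t} s * \<phi> x))"
      by (rule lborel_pair.Fubini_integral, rule loc_int_pair_integrable[OF w, where B = B and t = t and R = R])
         (use BR order_trans[OF abs_ge_zero BR(1)[of 0]] in \<open>auto simp: indicator_def\<close>)
    \<comment> \<open>For each s, translation invariance puts the shift on the test function, and
      the translated test function is again admissible for the weak derivative.\<close>
    also have "\<dots> = (LINT s|lborel. LINT y|lborel. v y * (indicator {0..t} s * - partial_deriv i \<phi> (y - s *\<^sub>R ?e)))"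
    proof (rule Bochner_Integration.integral_cong)
      fix s :: real
      have "(LINT x|lborel. w (x + s *\<^sub>R ?e) * (indicator {0..t} s * \<phi> x))
         = (LINT x|lborel. w (x + s *\<^sub>R ?e) * (indicator {0..t} s * \<phi> (x + s *\<^sub>R ?e - s *\<^sub>R ?e)))" by simp
      also have "\<dots> = (LINT y|lborel. w y * (indicator {0..t} s * \<phi> (y - s *\<^sub>R ?e)))"
        by (rule lborel_integral_shift(1)) measurable
      also have "\<dots> = indicator {0..t} s * (LINT y|lborel. w y * \<phi> (y - s *\<^sub>R ?e))"
        by (subst integral_mult_right_zero[symmetric]) (simp add: mult_ac)
      also have "(LINT y|lborel. w y * \<phi> (y - s *\<^sub>R ?e)) = - (LINT y|lborel. v y * partial_deriv i \<phi> (y - s *\<^sub>R ?e))"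
        using vw test_function_shift[OF \<phi>, where a = "s *\<^sub>R ?e"] unfolding weak_pd_def by fastforce
      also have "indicator {0..t} s * - (LINT y|lborel. v y * partial_deriv i \<phi> (y - s *\<^sub>R ?e))
          = (LINT y|lborel. v y * (indicator {0..t} s * - partial_deriv i \<phi> (y - s *\<^sub>R ?e)))"
        by (subst integral_minus[symmetric], subst integral_mult_right_zero[symmetric]) (simp add: mult_ac)
      finally show "(LINT x|lborel. w (x + s *\<^sub>R ?e) * (indicator {0..t} s * \<phi> x))
        = (LINT y|lborel. v y * (indicator {0..t} s * - partial_deriv i \<phi> (y - s *\<^sub>R ?e)))" .
    qed simp
    also have "\<dots> = (LINT y|lborel. LINT s|lborel. v y * (indicator {0..t} s * - partial_deriv i \<phi> (y - s *\<^sub>R ?e)))"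
    proof (rule lborel_pair.Fubini_integral[symmetric])
      \<comment> \<open>The radius grows to R + t because a shift by s \<le> t can bring such points
        back into the support. The direction 0 then lets the general integrability lemma apply with
        v unshifted.\<close>
      have "indicator {0..t} s * - partial_deriv i \<phi> (x - s *\<^sub>R ?e) = 0" if "s \<notin> {0..t} \<or> R + t < norm x" for s x
      proof (cases "s \<in> {0..t}")
        case True
        have "norm x \<le> norm (x - s *\<^sub>R ?e) + norm (s *\<^sub>R ?e)" using norm_triangle_ineq[of "x - s *\<^sub>R ?e" "s *\<^sub>R ?e"] by simp
        then have "norm (x - s *\<^sub>R ?e) > R" using that True by simp
        then show ?thesis by (simp add: BR)
      qed simp
      then have "integrable (lborel \<Otimes>\<^sub>M lborel) (\<lambda>(s, y). v (y + s *\<^sub>R 0) * (indicator {0..t} s * - partial_deriv i \<phi> (y - s *\<^sub>R ?e)))"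
        by (intro loc_int_pair_integrable[OF v, where B = B and t = t and R = "R + t"])
           (use BR(2) order_trans[OF abs_ge_zero BR(1)[of 0]] in \<open>auto simp: indicator_def\<close>)
      then show "integrable (lborel \<Otimes>\<^sub>M lborel) (\<lambda>(s, y). v y * (indicator {0..t} s * - partial_deriv i \<phi> (y - s *\<^sub>R ?e)))"
        by simp
    qed
    also have "\<dots> = (LINT y|lborel. v y * (\<phi> (y - t *\<^sub>R ?e) - \<phi> y))"
    proof (rule Bochner_Integration.integral_cong)
      fix y
      show "(LINT s|lborel. v y * (indicator {0..t} s * - partial_deriv i \<phi> (y - s *\<^sub>R ?e))) = v y * (\<phi> (y - t *\<^sub>R ?e) - \<phi> y)"
        using test_function_line_integral[OF \<phi> \<open>t \<ge> 0\<close>, of i y] by (simp add: right_diff_distrib)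
    qed simp
    also have "\<dots> = (LINT y|lborel. v y * \<phi> (y - t *\<^sub>R ?e)) - (LINT y|lborel. v y * \<phi> y)"
      using v \<phi> test_function_shift(1)[OF \<phi>] by (simp add: right_diff_distrib loc_int_test_integrable(1))
    also have "(LINT y|lborel. v y * \<phi> (y - t *\<^sub>R ?e)) = (LINT x|lborel. v (x + t *\<^sub>R ?e) * \<phi> x)"
      using lborel_integral_shift(1)[of "\<lambda>y. v y * \<phi> (y - t *\<^sub>R ?e)" "t *\<^sub>R ?e"] by simp
    finally have *: "(LINT x|lborel. W x * \<phi> x) = (LINT x|lborel. v (x + t *\<^sub>R ?e) * \<phi> x) - (LINT y|lborel. v y * \<phi> y)" .
    show "(LINT x|lborel. ((v (x + t *\<^sub>R ?e) - v x) - W x) * \<phi> x) = 0"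
      using v W \<phi> by (simp add: left_diff_distrib loc_int_test_integrable(1) loc_int_shift *)
  qed
  then show ?thesis unfolding W_def by eventually_elim simp
qed

text \<open>Integrating the line formula over A and exchanging integrals, each slice sees A shifted
  by s \<le> t, still inside the ball of radius R + t; the slices add up to the factor t.
  Nonnegative integrals avoid integrability side conditions.\<close>

lemma weak_pd_increment_bound:
  fixes v :: "real^'n::finite \<Rightarrow> real"
  assumes vw: "weak_pd i v w" and "t \<ge> 0" and A[measurable]: "A \<in> sets borel" and AR: "A \<subseteq> cball 0 R"
  shows "(\<integral>\<^sup>+x. indicator A x * ennreal \<bar>v (x + t *\<^sub>R axis i 1) - v x\<bar> \<partial>lborel)
    \<le> ennreal t * (\<integral>\<^sup>+x. indicator (cball 0 (R + t)) x * ennreal \<bar>w x\<bar> \<partial>lborel)"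
proof -
  let ?e = "axis i 1 :: real^'n"
  have v: "loc_int v" and w: "loc_int w" using vw by (auto simp: weak_pd_def)
  have [measurable]: "v \<in> borel_measurable borel" "w \<in> borel_measurable borel"
    using v w by measurable
  have "(\<integral>\<^sup>+x. indicator A x * ennreal \<bar>v (x + t *\<^sub>R ?e) - v x\<bar> \<partial>lborel)
    \<le> (\<integral>\<^sup>+x. indicator A x * (\<integral>\<^sup>+s. indicator {0..t} s * ennreal \<bar>w (x + s *\<^sub>R ?e)\<bar> \<partial>lborel) \<partial>lborel)"
  proof (rule nn_integral_mono_AE)
    show "AE x in lborel. indicator A x * ennreal \<bar>v (x + t *\<^sub>R ?e) - v x\<bar>
       \<le> indicator A x * (\<integral>\<^sup>+s. indicator {0..t} s * ennreal \<bar>w (x + s *\<^sub>R ?e)\<bar> \<partial>lborel)"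
      using weak_pd_ftc[OF vw \<open>t \<ge> 0\<close>]
    proof eventually_elim
      case (elim x)
      have "ennreal \<bar>LINT s|lborel. indicator {0..t} s * w (x + s *\<^sub>R ?e)\<bar>
        \<le> (\<integral>\<^sup>+s. ennreal (norm (indicator {0..t} s * w (x + s *\<^sub>R ?e))) \<partial>lborel)"
        by (simp add: abs_integral_le_nn_integral)
      also have "\<dots> = (\<integral>\<^sup>+s. indicator {0..t} s * ennreal \<bar>w (x + s *\<^sub>R ?e)\<bar> \<partial>lborel)"
        by (intro nn_integral_cong) (auto simp: indicator_def)
      finally show ?case unfolding elim by (intro mult_left_mono) auto
    qed
  qed
  also have "\<dots> = (\<integral>\<^sup>+x. \<integral>\<^sup>+s. indicator A x * (indicator {0..t} s * ennreal \<bar>w (x + s *\<^sub>R ?e)\<bar>) \<partial>lborel \<partial>lborel)"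
    by (subst nn_integral_cmult) auto
  also have "\<dots> = (\<integral>\<^sup>+s. \<integral>\<^sup>+x. indicator A x * (indicator {0..t} s * ennreal \<bar>w (x + s *\<^sub>R ?e)\<bar>) \<partial>lborel \<partial>lborel)"
    by (rule lborel_pair.Fubini') measurable
  also have "\<dots> \<le> (\<integral>\<^sup>+s. (\<integral>\<^sup>+x. indicator (cball 0 (R + t)) x * ennreal \<bar>w x\<bar> \<partial>lborel) * indicator {0..t} s \<partial>lborel)"
  proof (rule nn_integral_mono)
    fix s :: real
    show "(\<integral>\<^sup>+x. indicator A x * (indicator {0..t} s * ennreal \<bar>w (x + s *\<^sub>R ?e)\<bar>) \<partial>lborel)
      \<le> (\<integral>\<^sup>+x. indicator (cball 0 (R + t)) x * ennreal \<bar>w x\<bar> \<partial>lborel) * indicator {0..t} s"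
    proof (cases "s \<in> {0..t}")
      case True
      have "(\<integral>\<^sup>+x. indicator A x * ennreal \<bar>w (x + s *\<^sub>R ?e)\<bar> \<partial>lborel)
        \<le> (\<integral>\<^sup>+x. indicator (cball 0 (R + t)) (x + s *\<^sub>R ?e) * ennreal \<bar>w (x + s *\<^sub>R ?e)\<bar> \<partial>lborel)"
      proof (intro nn_integral_mono mult_right_mono)
        fix x
        have "norm (x + s *\<^sub>R ?e) \<le> norm x + \<bar>s\<bar>" using norm_triangle_ineq[of x "s *\<^sub>R ?e"] by simp
        with AR True show "indicator A x \<le> (indicator (cball 0 (R + t)) (x + s *\<^sub>R ?e) :: ennreal)"
          by (force simp: indicator_def)
      qed simp
      also have "\<dots> = (\<integral>\<^sup>+x. indicator (cball 0 (R + t)) x * ennreal \<bar>w x\<bar> \<partial>lborel)"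
        by (rule lborel_nn_integral_shift) measurable
      finally show ?thesis using True by simp
    qed simp
  qed
  also have "\<dots> = (\<integral>\<^sup>+x. indicator (cball 0 (R + t)) x * ennreal \<bar>w x\<bar> \<partial>lborel) * ennreal t"
    using \<open>t \<ge> 0\<close> by (subst nn_integral_cmult_indicator) auto
  finally show ?thesis by (simp add: mult.commute)
qed

text \<open>A Landau-type interpolation inequality: t G(x) is the increment of u minus the integral
  of G(x + s e) - G(x) over s in {0..t}. The preceding bound makes each of these increments at most
  t times the integral of H, whence t^2 in total. The factor t stays on the left so that no division
  takes place in \<open>ennreal\<close>.\<close>

lemma weak_pd_interpolation:
  fixes u :: "real^'n::finite \<Rightarrow> real"
  assumes uG: "weak_pd i u G" and GH: "weak_pd i G H" and "t \<ge> 0"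
    and A[measurable]: "A \<in> sets borel" and AR: "A \<subseteq> cball 0 R"
  shows "ennreal t * (\<integral>\<^sup>+x. indicator A x * ennreal \<bar>G x\<bar> \<partial>lborel)
    \<le> (\<integral>\<^sup>+x. indicator A x * ennreal \<bar>u (x + t *\<^sub>R axis i 1) - u x\<bar> \<partial>lborel)
      + ennreal (t\<^sup>2) * (\<integral>\<^sup>+x. indicator (cball 0 (R + t)) x * ennreal \<bar>H x\<bar> \<partial>lborel)"
proof -
  let ?e = "axis i 1 :: real^'n"
  have u: "loc_int u" and G: "loc_int G" and H: "loc_int H" using assms by (auto simp: weak_pd_def)
  have [measurable]: "u \<in> borel_measurable borel" "G \<in> borel_measurable borel" "H \<in> borel_measurable borel"
    using u G H by measurable
  let ?C = "\<integral>\<^sup>+x. indicator (cball 0 (R + t)) x * ennreal \<bar>H x\<bar> \<partial>lborel"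
  \<comment> \<open>Splitting off the constant G x under the real integral requires s-integrability
    of G along the segment; Fubini provides it for almost every x.\<close>
  have "integrable (lborel \<Otimes>\<^sub>M lborel) (\<lambda>(s, x). G (x + s *\<^sub>R ?e) * (indicator {0..t} s * indicator (cball 0 R) x))"
    by (rule loc_int_pair_integrable[OF G, where B = 1 and t = t and R = R]) (auto simp: indicator_def)
  then have "AE x in lborel. integrable lborel (\<lambda>s. G (x + s *\<^sub>R ?e) * (indicator {0..t} s * indicator (cball 0 R) x))"
    using lborel_pair.AE_integrable_snd by fastforce
  then have "AE x in lborel. indicator A x * (ennreal t * ennreal \<bar>G x\<bar>) \<le> indicator A x * ennreal \<bar>u (x + t *\<^sub>R ?e) - u x\<bar>
      + indicator A x * (\<integral>\<^sup>+s. indicator {0..t} s * ennreal \<bar>G (x + s *\<^sub>R ?e) - G x\<bar> \<partial>lborel)"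
    using weak_pd_ftc[OF uG \<open>t \<ge> 0\<close>]
  proof eventually_elim
    case (elim x)
    show ?case
    proof (cases "x \<in> A")
      case True
      then have int: "integrable lborel (\<lambda>s. indicator {0..t} s * G (x + s *\<^sub>R ?e))"
        using elim(1) AR by (auto simp: mult.commute)
      have intc: "integrable lborel (\<lambda>s. indicator {0..t} s * G x)" by (simp add: emeasure_lborel_Icc_eq)
      have "(LINT s|lborel. indicator {0..t} s * (G (x + s *\<^sub>R ?e) - G x)) = u (x + t *\<^sub>R ?e) - u x - t * G x"
        using int intc \<open>t \<ge> 0\<close> by (simp add: right_diff_distrib elim(2))
      then have "t * \<bar>G x\<bar> \<le> \<bar>u (x + t *\<^sub>R ?e) - u x\<bar> + \<bar>LINT s|lborel. indicator {0..t} s * (G (x + s *\<^sub>R ?e) - G x)\<bar>"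
        using \<open>t \<ge> 0\<close> by (simp add: abs_mult[of t, symmetric, unfolded abs_of_nonneg[OF \<open>t \<ge> 0\<close>]])
      then have "ennreal (t * \<bar>G x\<bar>) \<le> ennreal \<bar>u (x + t *\<^sub>R ?e) - u x\<bar> + ennreal \<bar>LINT s|lborel. indicator {0..t} s * (G (x + s *\<^sub>R ?e) - G x)\<bar>"
        by (simp add: ennreal_leI flip: ennreal_plus)
      also have "ennreal \<bar>LINT s|lborel. indicator {0..t} s * (G (x + s *\<^sub>R ?e) - G x)\<bar>
         \<le> (\<integral>\<^sup>+s. ennreal (norm (indicator {0..t} s * (G (x + s *\<^sub>R ?e) - G x))) \<partial>lborel)"
        by (simp add: abs_integral_le_nn_integral)
      also have "\<dots> = (\<integral>\<^sup>+s. indicator {0..t} s * ennreal \<bar>G (x + s *\<^sub>R ?e) - G x\<bar> \<partial>lborel)"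
        by (intro nn_integral_cong) (auto simp: indicator_def)
      finally show ?thesis using True \<open>t \<ge> 0\<close> by (simp add: ennreal_mult')
    qed simp
  qed
  then have "(\<integral>\<^sup>+x. indicator A x * (ennreal t * ennreal \<bar>G x\<bar>) \<partial>lborel)
    \<le> (\<integral>\<^sup>+x. (indicator A x * ennreal \<bar>u (x + t *\<^sub>R ?e) - u x\<bar>
      + indicator A x * (\<integral>\<^sup>+s. indicator {0..t} s * ennreal \<bar>G (x + s *\<^sub>R ?e) - G x\<bar> \<partial>lborel)) \<partial>lborel)"
    by (rule nn_integral_mono_AE)
  also have "\<dots> = (\<integral>\<^sup>+x. indicator A x * ennreal \<bar>u (x + t *\<^sub>R ?e) - u x\<bar> \<partial>lborel)
      + (\<integral>\<^sup>+x. indicator A x * (\<integral>\<^sup>+s. indicator {0..t} s * ennreal \<bar>G (x + s *\<^sub>R ?e) - G x\<bar> \<partial>lborel) \<partial>lborel)"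
    by (rule nn_integral_add) measurable
  also have "(\<integral>\<^sup>+x. indicator A x * (\<integral>\<^sup>+s. indicator {0..t} s * ennreal \<bar>G (x + s *\<^sub>R ?e) - G x\<bar> \<partial>lborel) \<partial>lborel)
      = (\<integral>\<^sup>+x. \<integral>\<^sup>+s. indicator A x * (indicator {0..t} s * ennreal \<bar>G (x + s *\<^sub>R ?e) - G x\<bar>) \<partial>lborel \<partial>lborel)"
    by (subst nn_integral_cmult) auto
  also have "\<dots> = (\<integral>\<^sup>+s. \<integral>\<^sup>+x. indicator A x * (indicator {0..t} s * ennreal \<bar>G (x + s *\<^sub>R ?e) - G x\<bar>) \<partial>lborel \<partial>lborel)"
    by (rule lborel_pair.Fubini') measurable
  also have "\<dots> \<le> (\<integral>\<^sup>+s. (ennreal t * ?C) * indicator {0..t} s \<partial>lborel)"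
  proof (rule nn_integral_mono)
    fix s :: real
    show "(\<integral>\<^sup>+x. indicator A x * (indicator {0..t} s * ennreal \<bar>G (x + s *\<^sub>R ?e) - G x\<bar>) \<partial>lborel)
      \<le> (ennreal t * ?C) * indicator {0..t} s"
    proof (cases "s \<in> {0..t}")
      case True
      have "(\<integral>\<^sup>+x. indicator A x * ennreal \<bar>G (x + s *\<^sub>R ?e) - G x\<bar> \<partial>lborel)
        \<le> ennreal s * (\<integral>\<^sup>+x. indicator (cball 0 (R + s)) x * ennreal \<bar>H x\<bar> \<partial>lborel)"
        using True by (intro weak_pd_increment_bound GH A AR) auto
      also have "\<dots> \<le> ennreal t * ?C"
        using True by (intro mult_mono ennreal_leI nn_integral_mono) (auto simp: indicator_def)
      finally show ?thesis using True by simp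
    qed simp
  qed
  also have "\<dots> = (ennreal t * ?C) * ennreal t"
    using \<open>t \<ge> 0\<close> by (subst nn_integral_cmult_indicator) auto
  also have "\<dots> = ennreal (t\<^sup>2) * ?C"
    using \<open>t \<ge> 0\<close> by (simp add: power2_eq_square ennreal_mult' mult_ac)
  also have "(\<integral>\<^sup>+x. indicator A x * (ennreal t * ennreal \<bar>G x\<bar>) \<partial>lborel)
    = ennreal t * (\<integral>\<^sup>+x. indicator A x * ennreal \<bar>G x\<bar> \<partial>lborel)"
    by (subst nn_integral_cmult[symmetric]) (auto simp: mult_ac)
  finally show ?thesis by (simp add: add_left_mono)
qed

section \<open>Exponential decay of the gradient\<close>

lemma nn_integral_exp_abs_finite:
  assumes "c > 0"
  shows "(\<integral>\<^sup>+(x::real). ennreal (exp (- c * \<bar>x\<bar>)) \<partial>lborel) < \<infinity>"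
proof -
  have *: "(\<integral>\<^sup>+(x::real). ennreal (exp (- c * x)) * indicator {0..} x \<partial>lborel) = ennreal (1 / c)"
  proof -
    have "(\<integral>\<^sup>+(x::real). ennreal (exp (- c * x)) * indicator {0..} x \<partial>lborel) = ennreal (0 - (- exp (- c * 0) / c))"
    proof (rule nn_integral_FTC_atLeast)
      show "((\<lambda>x. - exp (- c * x) / c) has_real_derivative exp (- c * x)) (at x)" for x
        using assms by (auto intro!: derivative_eq_intros)
      show "((\<lambda>x. - exp (- c * x) / c) \<longlongrightarrow> 0) at_top" using assms by real_asymp
    qed auto
    then show ?thesis by simp
  qed
  have "(\<integral>\<^sup>+(x::real). ennreal (exp (- c * \<bar>x\<bar>)) \<partial>lborel)
    \<le> (\<integral>\<^sup>+x. ennreal (exp (- c * x)) * indicator {0..} x + ennreal (exp (- c * (- x))) * indicator {0..} (- x) \<partial>lborel)"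
    by (rule nn_integral_mono) (auto simp: indicator_def)
  also have "\<dots> = (\<integral>\<^sup>+x. ennreal (exp (- c * x)) * indicator {0..} x \<partial>lborel)
      + (\<integral>\<^sup>+x. ennreal (exp (- c * (- x))) * indicator {0..} (- x) \<partial>lborel)"
    by (rule nn_integral_add) auto
  also have "(\<integral>\<^sup>+x. ennreal (exp (- c * (- x))) * indicator {0..} (- x) \<partial>lborel)
    = (\<integral>\<^sup>+(x::real). ennreal (exp (- c * x)) * indicator {0..} x \<partial>lborel)"
    using nn_integral_real_affine[of "\<lambda>x. ennreal (exp (- c * x)) * indicator {0..} x" "-1" 0] by simp
  finally show ?thesis unfolding * by (rule le_less_trans) simp
qed

lemma nn_integral_exp_norm_finite:
  assumes "c > 0"
  shows "(\<integral>\<^sup>+(x::'a::euclidean_space). ennreal (exp (- c * norm x)) \<partial>lborel) < \<infinity>"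
proof -
  \<comment> \<open>The absolute values of the coordinates add up to at most \<open>DIM('a)\<close>
    times the norm, so at this rate a product of one-dimensional exponentials dominates.\<close>
  define d where "d = c / DIM('a)"
  have d: "d > 0" using assms by (simp add: d_def)
  have "(\<integral>\<^sup>+(x::'a). ennreal (exp (- c * norm x)) \<partial>lborel)
    \<le> (\<integral>\<^sup>+(x::'a). (\<Prod>b\<in>Basis. ennreal (exp (- d * \<bar>x \<bullet> b\<bar>))) \<partial>lborel)"
  proof (rule nn_integral_mono)
    fix x :: 'a
    have "(\<Sum>b\<in>Basis. d * \<bar>x \<bullet> b\<bar>) \<le> (\<Sum>b\<in>(Basis::'a set). d * norm x)"
      using d by (intro sum_mono mult_left_mono) (auto simp: Basis_le_norm)
    also have "\<dots> = c * norm x" by (simp add: d_def)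
    finally have "exp (- c * norm x) \<le> exp (\<Sum>b\<in>Basis. - d * \<bar>x \<bullet> b\<bar>)" by (simp add: sum_negf)
    also have "\<dots> = (\<Prod>b\<in>Basis. exp (- d * \<bar>x \<bullet> b\<bar>))" by (simp add: exp_sum)
    finally show "ennreal (exp (- c * norm x)) \<le> (\<Prod>b\<in>Basis. ennreal (exp (- d * \<bar>x \<bullet> b\<bar>)))"
      by (simp add: prod_ennreal ennreal_leI)
  qed
  also have "\<dots> = (\<Prod>b\<in>(Basis::'a set). \<integral>\<^sup>+x. ennreal (exp (- d * \<bar>x\<bar>)) \<partial>lborel)"
    by (rule nn_integral_lborel_prod) auto
  also have "\<dots> < \<infinity>"
    using nn_integral_exp_abs_finite[OF d] by (simp add: power_less_top_ennreal)
  finally show ?thesis .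
qed

text \<open>The rate 8d is a budget. On the k-th annulus the increment of u is of size exp (-7dk),
  one d being kept to integrate over space; the integral of H costs exp (dk). Interpolation with the
  balancing step gives exp (-3dk) for G, which still beats the weight exp (dk).\<close>

lemma weak_pd_exponential_decay:
  fixes u :: "real^'n::finite \<Rightarrow> real"
  assumes uG: "weak_pd i u G" and GH: "weak_pd i G H"
    and u: "AE x in lborel. \<bar>u x\<bar> \<le> L * exp (- (8 * d) * norm x)"
    and H: "(\<integral>\<^sup>+x. ennreal (\<bar>H x\<bar> powr p) \<partial>lborel) < \<infinity>" and "p \<ge> 1" "d > 0" "L \<ge> 0"
  shows "(\<integral>\<^sup>+x. ennreal (exp (d * norm x) * \<bar>G x\<bar>) \<partial>lborel) < \<infinity>"
proof -
  let ?e = "axis i 1 :: real^'n"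
  have [measurable]: "u \<in> borel_measurable borel" "G \<in> borel_measurable borel" "H \<in> borel_measurable borel"
    using assms by (auto simp: weak_pd_def loc_int_measurable)
  define E where "E = (\<integral>\<^sup>+x. ennreal (exp (- d * norm (x::real^'n))) \<partial>lborel)"
  define K where "K = (\<integral>\<^sup>+x. ennreal (exp (- d * norm x) * \<bar>H x\<bar>) \<partial>lborel)"
  have E: "E < \<infinity>" unfolding E_def by (rule nn_integral_exp_norm_finite) fact
  \<comment> \<open>In place of Hoelder's inequality: where |H| \<le> 1 the exponential dominates,
    and elsewhere |H| is at most its p-th power, as p \<ge> 1.\<close>
  have "K \<le> (\<integral>\<^sup>+x. ennreal (exp (- d * norm x)) + ennreal (\<bar>H x\<bar> powr p) \<partial>lborel)"
    unfolding K_def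
  proof (rule nn_integral_mono)
    fix x
    have "exp (- d * norm x) * \<bar>H x\<bar> \<le> exp (- d * norm x) + \<bar>H x\<bar> powr p"
    proof (cases "\<bar>H x\<bar> \<le> 1")
      case True
      then show ?thesis by (intro add_increasing2) (auto intro: mult_left_le)
    next
      case False
      then have "\<bar>H x\<bar> \<le> \<bar>H x\<bar> powr p" using powr_mono[of 1 p "\<bar>H x\<bar>"] \<open>p \<ge> 1\<close> by simp
      moreover have "exp (- d * norm x) * \<bar>H x\<bar> \<le> \<bar>H x\<bar>" using \<open>d > 0\<close> by (intro mult_left_le_one_le) auto
      ultimately show ?thesis by (intro add_increasing) auto
    qed
    then show "ennreal (exp (- d * norm x) * \<bar>H x\<bar>) \<le> ennreal (exp (- d * norm x)) + ennreal (\<bar>H x\<bar> powr p)"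
      by (simp add: ennreal_leI flip: ennreal_plus)
  qed
  also have "\<dots> = E + (\<integral>\<^sup>+x. ennreal (\<bar>H x\<bar> powr p) \<partial>lborel)"
    unfolding E_def by (rule nn_integral_add) auto
  finally have K: "K < \<infinity>" using E H by (simp add: le_less_trans)

  define A :: "nat \<Rightarrow> (real^'n) set" where "A k = {x. real k \<le> norm x \<and> norm x < real k + 1}" for k
  have A[measurable]: "A k \<in> sets borel" for k unfolding A_def by measurable
  define D where "D = ennreal (2 * L * exp (8 * d)) * E + ennreal (exp (2 * d)) * K"
  have D: "D < \<infinity>" using E K by (simp add: D_def ennreal_mult_less_top)
  have I: "(\<integral>\<^sup>+x. indicator (A k) x * ennreal \<bar>G x\<bar> \<partial>lborel) \<le> D * ennreal (exp (- (3 * d) * real k))" for k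
  proof -
    \<comment> \<open>After division by t the two terms are of size exp (-7dk) / t and t exp (dk);
      this t makes both equal to exp (-3dk).\<close>
    define t where "t = exp (- (4 * d) * real k)"
    have t: "0 < t" "t \<le> 1" using \<open>d > 0\<close> by (auto simp: t_def)
    let ?I = "\<integral>\<^sup>+x. indicator (A k) x * ennreal \<bar>G x\<bar> \<partial>lborel"
    have "ennreal t * ?I
      \<le> (\<integral>\<^sup>+x. indicator (A k) x * ennreal \<bar>u (x + t *\<^sub>R ?e) - u x\<bar> \<partial>lborel)
        + ennreal (t\<^sup>2) * (\<integral>\<^sup>+x. indicator (cball 0 (real k + 1 + t)) x * ennreal \<bar>H x\<bar> \<partial>lborel)"
      using t by (intro weak_pd_interpolation[OF uG GH]) (auto simp: A_def)
    also have "(\<integral>\<^sup>+x. indicator (A k) x * ennreal \<bar>u (x + t *\<^sub>R ?e) - u x\<bar> \<partial>lborel)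
      \<le> (\<integral>\<^sup>+(x::real^'n). ennreal (2 * L * exp (8 * d) * exp (- (7 * d) * real k)) * ennreal (exp (- d * norm x)) \<partial>lborel)"
    proof (rule nn_integral_mono_AE)
      show "AE x in lborel. indicator (A k) x * ennreal \<bar>u (x + t *\<^sub>R ?e) - u x\<bar>
        \<le> ennreal (2 * L * exp (8 * d) * exp (- (7 * d) * real k)) * ennreal (exp (- d * norm x))"
        using u lborel_AE_shift[OF u, of "t *\<^sub>R ?e"]
      proof eventually_elim
        case (elim x)
        show ?case
        proof (cases "x \<in> A k")
          case True
          have "norm x - 1 \<le> norm (x + t *\<^sub>R ?e)"
            using norm_triangle_ineq4[of "x + t *\<^sub>R ?e" "t *\<^sub>R ?e"] t by simp
          then have "L * exp (- (8 * d) * norm (x + t *\<^sub>R ?e)) \<le> L * exp (- (8 * d) * (norm x - 1))"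
            using \<open>d > 0\<close> \<open>L \<ge> 0\<close> by (intro mult_left_mono) auto
          moreover have "L * exp (- (8 * d) * norm x) \<le> L * exp (- (8 * d) * (norm x - 1))"
            using \<open>d > 0\<close> \<open>L \<ge> 0\<close> by (intro mult_left_mono) auto
          ultimately have "\<bar>u (x + t *\<^sub>R ?e) - u x\<bar> \<le> 2 * L * exp (- (8 * d) * (norm x - 1))"
            using elim by linarith
          \<comment> \<open>The shift by t \<le> 1 costs exp (8d). Of the remaining decay, 7d is
            evaluated at k \<le> norm x, and one d stays on norm x so that integrating over the
            whole space gives E, with no volume of annuli to compute.\<close>
          also have "\<dots> \<le> 2 * L * exp (8 * d - (7 * d) * real k - d * norm x)"
          proof -
            have "d * real k \<le> d * norm x" using True \<open>d > 0\<close> by (simp add: A_def)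
            then show ?thesis using \<open>L \<ge> 0\<close> by (intro mult_left_mono) (auto simp: algebra_simps)
          qed
          also have "\<dots> = (2 * L * exp (8 * d) * exp (- (7 * d) * real k)) * exp (- d * norm x)"
            by (simp flip: exp_add)
          finally show ?thesis using True \<open>L \<ge> 0\<close> by (simp add: ennreal_leI flip: ennreal_mult)
        qed simp
      qed
    qed
    also have "\<dots> = ennreal (2 * L * exp (8 * d) * exp (- (7 * d) * real k)) * E"
      unfolding E_def by (rule nn_integral_cmult) auto
    also have "(\<integral>\<^sup>+x. indicator (cball 0 (real k + 1 + t)) x * ennreal \<bar>H x\<bar> \<partial>lborel)
      \<le> (\<integral>\<^sup>+x. ennreal (exp (d * (real k + 2))) * ennreal (exp (- d * norm x) * \<bar>H x\<bar>) \<partial>lborel)"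
    proof (rule nn_integral_mono)
      fix x
      \<comment> \<open>Since t \<le> 1 the ball has radius at most k + 2, which bounds the cost of
        inserting the weight exp (-d norm x).\<close>
      have "\<bar>H x\<bar> \<le> exp (d * (real k + 2)) * (exp (- d * norm x) * \<bar>H x\<bar>)" if "norm x \<le> real k + 1 + t"
      proof -
        have "1 \<le> exp (d * (real k + 2) - d * norm x)" using that t \<open>d > 0\<close> by (simp flip: right_diff_distrib)
        then show ?thesis
          using mult_right_mono[of 1 "exp (d * (real k + 2) - d * norm x)" "\<bar>H x\<bar>"]
          by (simp add: exp_diff exp_minus field_simps)
      qed
      then show "indicator (cball 0 (real k + 1 + t)) x * ennreal \<bar>H x\<bar>
        \<le> ennreal (exp (d * (real k + 2))) * ennreal (exp (- d * norm x) * \<bar>H x\<bar>)"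
        by (auto simp: indicator_def ennreal_leI simp flip: ennreal_mult)
    qed
    also have "\<dots> = ennreal (exp (d * (real k + 2))) * K"
      unfolding K_def by (rule nn_integral_cmult) auto
    finally have "ennreal t * ?I \<le> ennreal (2 * L * exp (8 * d) * exp (- (7 * d) * real k)) * E
      + ennreal (t\<^sup>2) * (ennreal (exp (d * (real k + 2))) * K)"
      by (simp add: add_mono mult_left_mono)
    then have "ennreal (1 / t) * (ennreal t * ?I) \<le> ennreal (1 / t) * (ennreal (2 * L * exp (8 * d) * exp (- (7 * d) * real k)) * E
      + ennreal (t\<^sup>2) * (ennreal (exp (d * (real k + 2))) * K))"
      by (intro mult_left_mono) auto
    also have "ennreal (1 / t) * (ennreal t * ?I) = ?I"
      using t by (simp add: mult.assoc[symmetric] flip: ennreal_mult)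
    also have "ennreal (1 / t) * (ennreal (2 * L * exp (8 * d) * exp (- (7 * d) * real k)) * E
      + ennreal (t\<^sup>2) * (ennreal (exp (d * (real k + 2))) * K))
      = ennreal (1 / t * (2 * L * exp (8 * d) * exp (- (7 * d) * real k))) * E
      + ennreal (1 / t * (t\<^sup>2 * exp (d * (real k + 2)))) * K"
    proof -
      have "ennreal a * (ennreal b * E + ennreal c * (ennreal e * K)) = ennreal (a * b) * E + ennreal (a * (c * e)) * K"
        if "a \<ge> 0" "b \<ge> 0" "c \<ge> 0" "e \<ge> 0" for a b c e
        using that by (simp add: distrib_left ennreal_mult mult.assoc)
      then show ?thesis using t \<open>L \<ge> 0\<close> by simp
    qed
    also have "1 / t * (2 * L * exp (8 * d) * exp (- (7 * d) * real k)) = 2 * L * exp (8 * d) * exp (- (3 * d) * real k)"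
    proof -
      have "1 / t * exp (- (7 * d) * real k) = exp (4 * d * real k + - (7 * d) * real k)"
        unfolding t_def exp_add by (simp add: exp_minus inverse_eq_divide)
      also have "4 * d * real k + - (7 * d) * real k = - (3 * d) * real k" by simp
      finally have e: "1 / t * exp (- (7 * d) * real k) = exp (- (3 * d) * real k)" .
      have "1 / t * (2 * L * exp (8 * d) * exp (- (7 * d) * real k))
          = 2 * L * exp (8 * d) * (1 / t * exp (- (7 * d) * real k))" by simp
      then show ?thesis unfolding e .
    qed
    also have "1 / t * (t\<^sup>2 * exp (d * (real k + 2))) = exp (2 * d) * exp (- (3 * d) * real k)"
    proof -
      have "1 / t * (t\<^sup>2 * exp (d * (real k + 2))) = t * exp (d * (real k + 2))"
        using t by (simp add: power2_eq_square)
      also have "\<dots> = exp (2 * d) * exp (- (3 * d) * real k)"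
        unfolding t_def exp_add[symmetric] by (simp add: algebra_simps)
      finally show ?thesis .
    qed
    finally show ?thesis
      using \<open>L \<ge> 0\<close> by (simp add: D_def distrib_left distrib_right ennreal_mult mult_ac)
  qed
  have "(\<integral>\<^sup>+x. ennreal (exp (d * norm x) * \<bar>G x\<bar>) \<partial>lborel)
    \<le> (\<integral>\<^sup>+x. (\<Sum>k. ennreal (exp (d * (real k + 1))) * (indicator (A k) x * ennreal \<bar>G x\<bar>)) \<partial>lborel)"
  proof (rule nn_integral_mono)
    fix x :: "real^'n"
    define k where "k = nat \<lfloor>norm x\<rfloor>"
    have k: "real k \<le> norm x" "norm x < real k + 1" unfolding k_def by (auto simp: of_nat_floor)
    have "ennreal (exp (d * norm x) * \<bar>G x\<bar>) \<le> ennreal (exp (d * (real k + 1)) * \<bar>G x\<bar>)"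
      using k \<open>d > 0\<close> by (intro ennreal_leI mult_right_mono) auto
    also have "\<dots> = ennreal (exp (d * (real k + 1))) * (indicator (A k) x * ennreal \<bar>G x\<bar>)"
      using k by (simp add: A_def ennreal_mult')
    also have "\<dots> \<le> (\<Sum>k. ennreal (exp (d * (real k + 1))) * (indicator (A k) x * ennreal \<bar>G x\<bar>))"
      using sum_le_suminf[OF summableI, of "{k}" "\<lambda>k. ennreal (exp (d * (real k + 1))) * (indicator (A k) x * ennreal \<bar>G x\<bar>)"]
      by simp
    finally show "ennreal (exp (d * norm x) * \<bar>G x\<bar>)
      \<le> (\<Sum>k. ennreal (exp (d * (real k + 1))) * (indicator (A k) x * ennreal \<bar>G x\<bar>))" .
  qed
  also have "\<dots> = (\<Sum>k. \<integral>\<^sup>+x. ennreal (exp (d * (real k + 1))) * (indicator (A k) x * ennreal \<bar>G x\<bar>) \<partial>lborel)"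
    by (rule nn_integral_suminf) measurable
  also have "\<dots> = (\<Sum>k. ennreal (exp (d * (real k + 1))) * (\<integral>\<^sup>+x. indicator (A k) x * ennreal \<bar>G x\<bar> \<partial>lborel))"
    by (subst nn_integral_cmult) auto
  \<comment> \<open>The weight is at most exp (d(k + 1)) on the k-th annulus; against exp (-3dk) it
    leaves a geometric series of ratio exp (-2d).\<close>
  also have "\<dots> \<le> (\<Sum>k. (D * ennreal (exp d)) * ennreal (exp (- (2 * d)) ^ k))"
  proof (rule suminf_le[OF _ summableI summableI])
    fix k
    have "ennreal (exp (d * (real k + 1))) * (\<integral>\<^sup>+x. indicator (A k) x * ennreal \<bar>G x\<bar> \<partial>lborel)
      \<le> ennreal (exp (d * (real k + 1))) * (D * ennreal (exp (- (3 * d) * real k)))"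
      by (intro mult_left_mono I) simp
    also have "\<dots> = D * ennreal (exp (d * (real k + 1)) * exp (- (3 * d) * real k))"
      by (simp add: ennreal_mult mult_ac)
    also have "exp (d * (real k + 1)) * exp (- (3 * d) * real k) = exp d * exp (- (2 * d)) ^ k"
      by (simp add: algebra_simps flip: exp_add exp_of_nat_mult)
    finally show "ennreal (exp (d * (real k + 1))) * (\<integral>\<^sup>+x. indicator (A k) x * ennreal \<bar>G x\<bar> \<partial>lborel)
      \<le> (D * ennreal (exp d)) * ennreal (exp (- (2 * d)) ^ k)"
      by (simp add: ennreal_mult mult_ac)
  qed
  also have "\<dots> = (D * ennreal (exp d)) * (\<Sum>k. ennreal (exp (- (2 * d)) ^ k))"
    by (rule ennreal_suminf_cmult)
  also have "(\<Sum>k. ennreal (exp (- (2 * d)) ^ k)) = ennreal (\<Sum>k. exp (- (2 * d)) ^ k)"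
    using \<open>d > 0\<close> by (intro suminf_ennreal2) auto
  also have "(D * ennreal (exp d)) * \<dots> < \<infinity>" using D by (simp add: ennreal_mult_less_top)
  finally show ?thesis .
qed

section \<open>The Fourier transform of exponentially decaying functions\<close>

definition ftrans :: "('a::euclidean_space \<Rightarrow> complex) \<Rightarrow> 'a \<Rightarrow> complex" where
  "ftrans f \<xi> = (LINT x|lborel. exp (- \<i> * complex_of_real (x \<bullet> \<xi>)) * f x)"

lemma fourier_eq_ftrans: "f \<in> borel_measurable borel \<Longrightarrow> fourier f = ftrans f"
  unfolding fourier_def ftrans_def by (intro ext integral_completion) measurable

lemma norm_exp_minus_i [simp]: "norm (exp (- (\<i> * complex_of_real r))) = 1"
  by (simp add: norm_exp_eq_Re)

lemma continuous_on_ftrans: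
  assumes f: "integrable lborel f"
  shows "continuous_on UNIV (ftrans f)"
proof (rule continuous_at_imp_continuous_on, rule ballI)
  fix \<xi>
  have [measurable]: "f \<in> borel_measurable borel" using f by auto
  show "isCont (ftrans f) \<xi>"
    unfolding continuous_at_sequentially o_def ftrans_def
  proof safe
    fix X assume X: "X \<longlonglongrightarrow> \<xi>"
    show "(\<lambda>n. LINT x|lborel. exp (- \<i> * complex_of_real (x \<bullet> X n)) * f x) \<longlonglongrightarrow>
        (LINT x|lborel. exp (- \<i> * complex_of_real (x \<bullet> \<xi>)) * f x)"
    proof (rule integral_dominated_convergence)
      show "integrable lborel (\<lambda>x. norm (f x))" using f by simp
    qed (auto simp: norm_mult intro!: tendsto_intros X)
  qed
qed

text \<open>The dilation s is built in so that one Fubini exchange serves twice: s = 1 handles the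
  distributional pairing, general s the Gaussian kernels of varying width.\<close>

lemma ftrans_duality:
  fixes f g :: "'a::euclidean_space \<Rightarrow> complex"
  assumes f: "integrable lborel f" and g: "integrable lborel g"
  shows "(LINT x|lborel. f x * ftrans g (s *\<^sub>R x)) = (LINT \<xi>|lborel. ftrans f (s *\<^sub>R \<xi>) * g \<xi>)"
proof -
  have [measurable]: "f \<in> borel_measurable borel" "g \<in> borel_measurable borel" using f g by auto
  have int: "integrable (lborel \<Otimes>\<^sub>M lborel) (\<lambda>(x, \<xi>). f x * (exp (- \<i> * complex_of_real (\<xi> \<bullet> (s *\<^sub>R x))) * g \<xi>))"
  proof (rule lborel_pair.Fubini_integrable)
    show "integrable lborel (\<lambda>x. LINT \<xi>|lborel. norm (case (x, \<xi>) of (x, \<xi>) \<Rightarrow> f x * (exp (- \<i> * complex_of_real (\<xi> \<bullet> (s *\<^sub>R x))) * g \<xi>)))"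
      using f by (simp add: norm_mult)
    show "AE x in lborel. integrable lborel (\<lambda>\<xi>. case (x, \<xi>) of (x, \<xi>) \<Rightarrow> f x * (exp (- \<i> * complex_of_real (\<xi> \<bullet> (s *\<^sub>R x))) * g \<xi>))"
    proof (rule AE_I2)
      fix x
      have "integrable lborel (\<lambda>\<xi>. exp (- \<i> * complex_of_real (\<xi> \<bullet> (s *\<^sub>R x))) * g \<xi>)"
        by (rule Bochner_Integration.integrable_bound[OF g]) (auto simp: norm_mult)
      then show "integrable lborel (\<lambda>\<xi>. case (x, \<xi>) of (x, \<xi>) \<Rightarrow> f x * (exp (- \<i> * complex_of_real (\<xi> \<bullet> (s *\<^sub>R x))) * g \<xi>))"
        by simp
    qed
  qed measurable
  have "(LINT x|lborel. f x * ftrans g (s *\<^sub>R x)) = (LINT x|lborel. LINT \<xi>|lborel. f x * (exp (- \<i> * complex_of_real (\<xi> \<bullet> (s *\<^sub>R x))) * g \<xi>))"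
    by (simp add: ftrans_def)
  also have "\<dots> = (LINT \<xi>|lborel. LINT x|lborel. f x * (exp (- \<i> * complex_of_real (\<xi> \<bullet> (s *\<^sub>R x))) * g \<xi>))"
    by (rule lborel_pair.Fubini_integral[symmetric, OF int])
  also have "\<dots> = (LINT \<xi>|lborel. ftrans f (s *\<^sub>R \<xi>) * g \<xi>)"
    unfolding ftrans_def by (subst integral_mult_left_zero[symmetric]) (simp add: mult_ac inner_commute)
  finally show ?thesis .
qed

text \<open>The Fourier transform on the line through \<open>w\<close>, extended to a complex strip.\<close>
definition ctrans :: "('a::euclidean_space \<Rightarrow> complex) \<Rightarrow> 'a \<Rightarrow> complex \<Rightarrow> complex" where
  "ctrans f w z = (LINT x|lborel. exp (- \<i> * z * complex_of_real (x \<bullet> w)) * f x)"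

lemma ctrans_of_real: "ctrans f w (complex_of_real t) = ftrans f (t *\<^sub>R w)"
  by (simp add: ctrans_def ftrans_def mult_ac)

text \<open>Differentiation under the integral sign by dominated convergence along sequences. The
  kernel has modulus at most exp (|Im z| norm x), and the gap between |Im z| and c pays for both the
  increment of z and the factor norm x produced by the derivative.\<close>

lemma ctrans_holomorphic:
  fixes f :: "'a::euclidean_space \<Rightarrow> complex"
  assumes f: "integrable lborel (\<lambda>x. exp (c * norm x) *\<^sub>R f x)"
    and [measurable]: "f \<in> borel_measurable borel" and w: "norm w = 1"
  shows "ctrans f w holomorphic_on {z. \<bar>Im z\<bar> < c}"
proof -
  have bd: "\<bar>x \<bullet> w\<bar> \<le> norm x" for x using Cauchy_Schwarz_ineq2[of x w] w by simp
  have int: "integrable lborel (\<lambda>x. exp (- \<i> * z * complex_of_real (x \<bullet> w)) * f x)" if "\<bar>Im z\<bar> \<le> c" for z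
  proof (rule Bochner_Integration.integrable_bound[OF f])
    show "AE x in lborel. norm (exp (- \<i> * z * complex_of_real (x \<bullet> w)) * f x) \<le> norm (exp (c * norm x) *\<^sub>R f x)"
    proof (rule AE_I2)
      fix x
      have "Im z * (x \<bullet> w) \<le> c * norm x"
        using mult_mono[OF that bd[of x]] that by (metis abs_ge_zero abs_ge_self abs_mult order_trans)
      then show "norm (exp (- \<i> * z * complex_of_real (x \<bullet> w)) * f x) \<le> norm (exp (c * norm x) *\<^sub>R f x)"
        by (auto simp: norm_mult norm_exp_eq_Re intro!: mult_right_mono)
    qed
  qed measurable
  have "\<exists>D. (ctrans f w has_field_derivative D) (at z)" if z: "\<bar>Im z\<bar> < c" for z
  proof -
    \<comment> \<open>Half the gap is spent on the exponential of the increment, the other half on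
      absorbing norm x \<le> exp (d norm x) / d.\<close>
    define d where "d = (c - \<bar>Im z\<bar>) / 2"
    have d: "d > 0" "\<bar>Im z\<bar> + 2 * d = c" using z by (auto simp: d_def field_simps)
    let ?E = "\<lambda>z x. exp (- \<i> * z * complex_of_real (x \<bullet> w)) * f x"
    define D where "D = (LINT x|lborel. (- \<i> * complex_of_real (x \<bullet> w)) * ?E z x)"
    have "((\<lambda>h. (ctrans f w (z + h) - ctrans f w z) / h) \<longlongrightarrow> D) (at 0)"
      unfolding tendsto_at_iff_sequentially o_def
    proof safe
      fix h assume hne: "\<forall>n::nat. h n \<in> UNIV - {0::complex}" and h: "h \<longlonglongrightarrow> 0"
      have "\<forall>\<^sub>F n in sequentially. norm (h n) < d"
        using tendstoD[OF h d(1)] by (simp add: dist_norm)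
      \<comment> \<open>The dominating function must work for every index, so the initial terms with
        large increments are dropped; \<open>LIMSEQ_offset\<close> restores them at the end.\<close>
      then obtain N where N: "\<And>n. n \<ge> N \<Longrightarrow> norm (h n) < d" by (auto simp: eventually_sequentially)
      define k where "k n = h (n + N)" for n
      have k: "k \<longlonglongrightarrow> 0" "\<And>n. norm (k n) < d" "\<And>n. k n \<noteq> 0"
        unfolding k_def using LIMSEQ_ignore_initial_segment[OF h, of N] N hne by auto
      have "(\<lambda>n. LINT x|lborel. (?E (z + k n) x - ?E z x) / k n) \<longlonglongrightarrow> D"
        unfolding D_def
      proof (rule integral_dominated_convergence)
        show "integrable lborel (\<lambda>x. norm (exp (c * norm x) *\<^sub>R f x) / d)"
          using f by (intro integrable_divide integrable_norm)
        show "AE x in lborel. (\<lambda>n. (?E (z + k n) x - ?E z x) / k n) \<longlonglongrightarrow> (- \<i> * complex_of_real (x \<bullet> w)) * ?E z x"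
        proof (rule AE_I2)
          fix x
          have "((\<lambda>z. ?E z x) has_field_derivative (- \<i> * complex_of_real (x \<bullet> w)) * ?E z x) (at z)"
            by (auto intro!: derivative_eq_intros)
          then have "((\<lambda>h. (?E (z + h) x - ?E z x) / h) \<longlongrightarrow> (- \<i> * complex_of_real (x \<bullet> w)) * ?E z x) (at 0)"
            by (simp add: DERIV_def)
          then show "(\<lambda>n. (?E (z + k n) x - ?E z x) / k n) \<longlonglongrightarrow> (- \<i> * complex_of_real (x \<bullet> w)) * ?E z x"
            using k unfolding tendsto_at_iff_sequentially o_def by auto
        qed
        show "AE x in lborel. norm ((?E (z + k n) x - ?E z x) / k n) \<le> norm (exp (c * norm x) *\<^sub>R f x) / d" for n
        proof (rule AE_I2)
          fix x
          let ?s = "x \<bullet> w"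
          have eq: "?E (z + k n) x - ?E z x = (exp (- \<i> * k n * complex_of_real ?s) - 1) * ?E z x"
            by (simp add: algebra_simps flip: exp_add)
          \<comment> \<open>\<open>Taylor_exp\<close> at order 0 is the bound |exp w - 1| \<le> exp
            |Re w| |w|; the factor |w| cancels the division by k n.\<close>
          have "norm (exp (- \<i> * k n * complex_of_real ?s) - 1) \<le> exp \<bar>Re (- \<i> * k n * complex_of_real ?s)\<bar> * norm (- \<i> * k n * complex_of_real ?s)"
            using Taylor_exp[of "- \<i> * k n * complex_of_real ?s" 0] by simp
          also have "\<dots> \<le> exp (d * norm x) * (norm (k n) * norm x)"
          proof (intro mult_mono)
            have "\<bar>Im (k n)\<bar> * \<bar>?s\<bar> \<le> d * norm x"
              using abs_Im_le_cmod[of "k n"] k(2)[of n] bd[of x] by (intro mult_mono) auto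
            then show "exp \<bar>Re (- \<i> * k n * complex_of_real ?s)\<bar> \<le> exp (d * norm x)"
              by (simp add: abs_mult)
            show "norm (- \<i> * k n * complex_of_real ?s) \<le> norm (k n) * norm x"
              using bd[of x] by (simp add: norm_mult mult_left_mono)
          qed auto
          finally have 1: "norm (exp (- \<i> * k n * complex_of_real ?s) - 1) \<le> exp (d * norm x) * (norm (k n) * norm x)" .
          have 2: "norm (exp (- \<i> * z * complex_of_real ?s)) \<le> exp (\<bar>Im z\<bar> * norm x)"
          proof -
            have "Im z * ?s \<le> \<bar>Im z\<bar> * norm x"
              using mult_mono[OF order_refl bd[of x], of "\<bar>Im z\<bar>"] by (metis abs_ge_zero abs_ge_self abs_mult order_trans)
            then show ?thesis by (simp add: norm_exp_eq_Re)
          qed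
          have "norm ((?E (z + k n) x - ?E z x) / k n)
            = norm (exp (- \<i> * k n * complex_of_real ?s) - 1) * (norm (exp (- \<i> * z * complex_of_real ?s)) * norm (f x)) / norm (k n)"
            unfolding eq by (simp add: norm_mult norm_divide)
          also have "\<dots> \<le> exp (d * norm x) * (norm (k n) * norm x) * (exp (\<bar>Im z\<bar> * norm x) * norm (f x)) / norm (k n)"
            by (intro divide_right_mono mult_mono 1 2) auto
          also have "\<dots> = exp (d * norm x) * exp (\<bar>Im z\<bar> * norm x) * (norm x * norm (f x))"
            using k(3)[of n] by simp
          also have "\<dots> \<le> exp (d * norm x) * exp (\<bar>Im z\<bar> * norm x) * (exp (d * norm x) / d * norm (f x))"
          proof (intro mult_left_mono mult_right_mono)
            have "d * norm x \<le> exp (d * norm x)" using exp_ge_add_one_self[of "d * norm x"] by linarith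
            then show "norm x \<le> exp (d * norm x) / d" using d by (simp add: field_simps)
          qed auto
          also have "\<dots> = norm (exp (c * norm x) *\<^sub>R f x) / d"
          proof -
            have "exp (d * norm x) * exp (\<bar>Im z\<bar> * norm x) * exp (d * norm x) = exp (c * norm x)"
              unfolding d(2)[symmetric] by (simp add: algebra_simps flip: exp_add)
            then show ?thesis by simp
          qed
          finally show "norm ((?E (z + k n) x - ?E z x) / k n) \<le> norm (exp (c * norm x) *\<^sub>R f x) / d" .
        qed
      qed measurable
      also have "(\<lambda>n. LINT x|lborel. (?E (z + k n) x - ?E z x) / k n) = (\<lambda>n. (ctrans f w (z + k n) - ctrans f w z) / k n)"
      proof
        fix n
        have "\<bar>Im (z + k n)\<bar> \<le> c"
          using abs_Im_le_cmod[of "k n"] k(2)[of n] d by (simp add: abs_if split: if_splits)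
        then show "(LINT x|lborel. (?E (z + k n) x - ?E z x) / k n) = (ctrans f w (z + k n) - ctrans f w z) / k n"
          using int[of z] int[of "z + k n"] z by (simp add: ctrans_def)
      qed
      finally have "(\<lambda>n. (ctrans f w (z + h (n + N)) - ctrans f w z) / h (n + N)) \<longlonglongrightarrow> D"
        by (simp add: k_def)
      then show "(\<lambda>n. (ctrans f w (z + h n) - ctrans f w z) / h n) \<longlonglongrightarrow> D"
        by (rule LIMSEQ_offset)
    qed
    then show ?thesis by (auto simp: DERIV_def)
  qed
  then show ?thesis
    unfolding holomorphic_on_def field_differentiable_def
    by (auto intro: has_field_derivative_at_within)
qed

text \<open>The identity theorem on the positive half-line gives \<open>B z = z * A z\<close>, whereas
  \<open>B t = - t * A t\<close> on the negative one.\<close>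
lemma holomorphic_abs_multiple_zero:
  fixes A B :: "complex \<Rightarrow> complex"
  assumes c: "c > 0" and A: "A holomorphic_on {z. \<bar>Im z\<bar> < c}" and B: "B holomorphic_on {z. \<bar>Im z\<bar> < c}"
    and AB: "\<And>t::real. B (of_real t) = of_real \<bar>t\<bar> * A (of_real t)" and z: "\<bar>Im z\<bar> < c"
  shows "A z = 0"
proof -
  let ?S = "{z. \<bar>Im z\<bar> < c}"
  have S: "?S = {z. Im z < c} \<inter> {z. Im z > - c}" by auto
  have "open ?S" "connected ?S"
    unfolding S by (auto intro!: open_Int open_halfspace_Im_lt open_halfspace_Im_gt convex_connected
      convex_Int convex_halfspace_Im_lt convex_halfspace_Im_gt)
  have lim: "0 islimpt (of_real ` {0<..} :: complex set)" "0 islimpt (of_real ` {..<0} :: complex set)"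
  proof -
    show "0 islimpt (of_real ` {0<..} :: complex set)"
      unfolding islimpt_approachable by (auto simp: dist_norm intro!: bexI[of _ "_ / 2"])
    show "0 islimpt (of_real ` {..<0} :: complex set)"
      unfolding islimpt_approachable
    proof safe
      fix e :: real assume "e > 0"
      then show "\<exists>x'\<in>complex_of_real ` {..<0}. x' \<noteq> 0 \<and> dist x' 0 < e"
        by (intro bexI[OF _ imageI[of "- e / 2"]]) (auto simp: dist_norm)
    qed
  qed
  have BzA: "B z - z * A z = 0" if "z \<in> ?S" for z
  proof (rule analytic_continuation[of "\<lambda>z. B z - z * A z" ?S "of_real ` {0<..}" 0])
    show "(\<lambda>z. B z - z * A z) holomorphic_on ?S" using A B by (intro holomorphic_intros)
  qed (use \<open>open ?S\<close> \<open>connected ?S\<close> c lim that AB in auto)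
  show ?thesis
  proof (rule analytic_continuation[of A ?S "of_real ` {..<0}" 0])
    fix y assume "y \<in> complex_of_real ` {..<0}"
    then obtain t where t: "y = of_real t" "t < 0" by auto
    have "of_real \<bar>t\<bar> * A y = y * A y" using BzA[of y] AB[of t] t c by simp
    then have "2 * y * A y = 0" using t by simp
    then show "A y = 0" using t by simp
  qed (use \<open>open ?S\<close> \<open>connected ?S\<close> c lim z A in auto)
qed

text \<open>On the line spanned by a unit vector w the symbol becomes norm (t w) = |t|, so the
  one-variable lemma applies on each line. Lines through the origin cover the space; at \<xi> = 0,
  where no direction is singled out, any basis vector will do.\<close>

lemma ftrans_norm_multiple_zero:
  fixes f g :: "'a::euclidean_space \<Rightarrow> complex"
  assumes c: "c > 0" and f: "integrable lborel (\<lambda>x. exp (c * norm x) *\<^sub>R f x)" "f \<in> borel_measurable borel"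
    and g: "integrable lborel (\<lambda>x. exp (c * norm x) *\<^sub>R g x)" "g \<in> borel_measurable borel"
    and fg: "\<And>\<xi>. ftrans g \<xi> = of_real (norm \<xi>) * ftrans f \<xi>"
  shows "ftrans f \<xi> = 0"
proof -
  have *: "ftrans f (t *\<^sub>R w) = 0" if w: "norm w = 1" for t and w :: 'a
  proof -
    have "ctrans f w (of_real t) = 0"
    proof (rule holomorphic_abs_multiple_zero[OF c ctrans_holomorphic[OF f w] ctrans_holomorphic[OF g w]])
      show "ctrans g w (of_real t) = of_real \<bar>t\<bar> * ctrans f w (of_real t)" for t
        by (simp add: ctrans_of_real fg w)
    qed (use c in simp)
    then show ?thesis by (simp add: ctrans_of_real)
  qed
  show ?thesis
  proof (cases "\<xi> = 0")
    case True
    obtain b :: 'a where "b \<in> Basis" using nonempty_Basis by blast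
    then show ?thesis using *[of b 0] True by simp
  next
    case False
    then show ?thesis using *[of "\<xi> /\<^sub>R norm \<xi>" "norm \<xi>"] by simp
  qed
qed

section \<open>Injectivity of the Fourier transform\<close>

lemma lborel_integral_prod:
  fixes f :: "'a::euclidean_space \<Rightarrow> real \<Rightarrow> complex"
  assumes "\<And>b. b \<in> Basis \<Longrightarrow> integrable lborel (f b)"
  shows "(LINT x|lborel. (\<Prod>b\<in>Basis. f b (x \<bullet> b))) = (\<Prod>b\<in>Basis. LINT x|lborel. f b x)"
    and "integrable lborel (\<lambda>x. (\<Prod>b\<in>Basis. f b (x \<bullet> b)))"
proof -
  interpret product_sigma_finite "\<lambda>_::'a. lborel :: real measure" ..
  have [measurable]: "f b \<in> borel_measurable borel" if "b \<in> Basis" for b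
    using assms[OF that] by auto
  have m: "(\<lambda>x. (\<Prod>b\<in>Basis. f b (x \<bullet> b))) \<in> borel_measurable borel" by measurable
  have d: "(\<Prod>b\<in>Basis. f b ((\<Sum>b\<in>Basis. y b *\<^sub>R b) \<bullet> b)) = (\<Prod>b\<in>Basis. f b (y b))" for y
    by (intro prod.cong) auto
  show "(LINT x|lborel. (\<Prod>b\<in>Basis. f b (x \<bullet> b))) = (\<Prod>b\<in>Basis. LINT x|lborel. f b x)"
    using product_integral_prod[OF finite_Basis, of f] assms
    by (subst lborel_eq, subst integral_distr) (simp_all add: m d)
  show "integrable lborel (\<lambda>x. (\<Prod>b\<in>Basis. f b (x \<bullet> b)))"
    using product_integrable_prod[OF finite_Basis, of f] assms
    by (subst lborel_eq, subst integrable_distr_eq) (simp_all add: m d)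
qed

text \<open>The product form reduces the transform to one-dimensional characteristic
  functions.\<close>

definition gauss :: "'a::euclidean_space \<Rightarrow> complex" where
  "gauss x = (\<Prod>b\<in>Basis. complex_of_real (std_normal_density (x \<bullet> b)))"

lemma integrable_gauss: "integrable lborel gauss"
  unfolding gauss_def by (intro lborel_integral_prod(2)) (auto intro!: integrable_normal_density)

lemma ftrans_gauss: "ftrans gauss v = exp (- (norm v)\<^sup>2 / 2)"
proof -
  have c: "(LINT t|lborel. exp (- \<i> * complex_of_real (t * r)) * complex_of_real (std_normal_density t)) = exp (- r\<^sup>2 / 2)" for r :: real
  proof -
    \<comment> \<open>The kernel has the opposite sign from a characteristic function, hence the
      argument - r; the Gaussian is even.\<close>
    have "exp (- r\<^sup>2 / 2) = char std_normal_distribution (- r)"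
      by (simp add: char_std_normal_distribution)
    also have "\<dots> = (LINT t|lborel. std_normal_density t *\<^sub>R exp (\<i> * complex_of_real (- r * t)))"
      unfolding char_def by (rule integral_density) auto
    finally show ?thesis by (simp add: scaleR_conv_of_real mult_ac)
  qed
  have "ftrans gauss v = (LINT x|lborel. (\<Prod>b\<in>Basis. exp (- \<i> * complex_of_real ((x \<bullet> b) * (v \<bullet> b))) * complex_of_real (std_normal_density (x \<bullet> b))))"
    unfolding ftrans_def gauss_def
    by (simp add: prod.distrib exp_sum[symmetric] euclidean_inner[of _ v] sum_distrib_left sum_negf)
  also have "\<dots> = (\<Prod>b\<in>Basis. LINT t|lborel. exp (- \<i> * complex_of_real (t * (v \<bullet> b))) * complex_of_real (std_normal_density t))"
  proof (rule lborel_integral_prod(1))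
    fix b :: 'a
    show "integrable lborel (\<lambda>t. exp (- \<i> * complex_of_real (t * (v \<bullet> b))) * complex_of_real (std_normal_density t))"
    proof (rule Bochner_Integration.integrable_bound)
      show "integrable lborel std_normal_density" by (rule integrable_normal_density) simp
    qed (auto simp: norm_mult)
  qed
  also have "\<dots> = (\<Prod>b\<in>Basis. exp (- (v \<bullet> b)\<^sup>2 / 2))" unfolding c by simp
  also have "\<dots> = exp (- (norm v)\<^sup>2 / 2)"
  proof -
    have "(norm v)\<^sup>2 = (\<Sum>b\<in>Basis. (v \<bullet> b)\<^sup>2)"
      by (subst power2_norm_eq_inner, subst euclidean_inner) (simp add: power2_eq_square)
    then show ?thesis by (simp add: exp_sum[symmetric] sum_negf sum_divide_distrib[symmetric])
  qed
  finally show ?thesis .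
qed

lemma lborel_integral_scale:
  fixes f :: "'a::euclidean_space \<Rightarrow> 'b::{banach, second_countable_topology}"
  assumes [measurable]: "f \<in> borel_measurable borel" and "s \<noteq> 0"
  shows "(LINT y|lborel. f y) = \<bar>s\<bar> ^ DIM('a) *\<^sub>R (LINT z|lborel. f (a + s *\<^sub>R z))"
proof -
  have "(LINT y|lborel. f y) = (LINT y|density (distr lborel borel (\<lambda>x. a + s *\<^sub>R x)) (\<lambda>_. ennreal (\<bar>s\<bar> ^ DIM('a))). f y)"
    using lborel_affine[OF \<open>s \<noteq> 0\<close>, of a] by simp
  also have "\<dots> = (LINT y|distr lborel borel (\<lambda>x. a + s *\<^sub>R x). \<bar>s\<bar> ^ DIM('a) *\<^sub>R f y)"
    by (rule integral_density) auto
  also have "\<dots> = (LINT z|lborel. \<bar>s\<bar> ^ DIM('a) *\<^sub>R f (a + s *\<^sub>R z))"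
    by (rule integral_distr) auto
  finally show ?thesis by simp
qed

text \<open>A Gaussian centred at y is itself a Fourier transform, namely of a modulated Gaussian.
  Duality then moves the transform onto f, where it is zero.\<close>

lemma ftrans_zero_gauss_convolution:
  fixes f :: "'a::euclidean_space \<Rightarrow> complex"
  assumes f: "integrable lborel f" and zero: "\<And>\<xi>. ftrans f \<xi> = 0"
  shows "(LINT x|lborel. f x * exp (- (norm (s *\<^sub>R (x - y)))\<^sup>2 / 2)) = 0"
proof -
  have [measurable]: "(gauss :: 'a \<Rightarrow> complex) \<in> borel_measurable borel"
    using borel_measurable_integrable[OF integrable_gauss] by auto
  \<comment> \<open>The modulation shifts the transform: \<open>ftrans h (s *\<^sub>R x)\<close> is
    \<open>ftrans gauss (s *\<^sub>R (x - y))\<close>.\<close>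
  define h :: "'a \<Rightarrow> complex" where "h w = exp (- \<i> * complex_of_real (- (w \<bullet> (s *\<^sub>R y)))) * gauss w" for w
  have h: "integrable lborel h"
    by (rule Bochner_Integration.integrable_bound[OF integrable_gauss])
       (unfold h_def, measurable, auto simp: norm_mult norm_exp_eq_Re)
  have "ftrans h (s *\<^sub>R x) = ftrans gauss (s *\<^sub>R (x - y))" for x
    unfolding ftrans_def h_def mult.assoc[symmetric] exp_add[symmetric]
    by (simp add: algebra_simps inner_diff_right)
  then have "(LINT x|lborel. f x * exp (- (norm (s *\<^sub>R (x - y)))\<^sup>2 / 2)) = (LINT x|lborel. f x * ftrans h (s *\<^sub>R x))"
    by (simp add: ftrans_gauss)
  also have "\<dots> = 0" using ftrans_duality[OF f h, of s] zero by simp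
  finally show ?thesis .
qed

lemma integrable_exp_norm_square: "integrable lborel (\<lambda>z::'a::euclidean_space. exp (- (norm z)\<^sup>2 / 2))"
proof (rule Bochner_Integration.integrable_bound)
  show "integrable lborel (\<lambda>z::'a. exp (1 / 2) * exp (- 1 * norm z))"
    using nn_integral_exp_norm_finite[of 1, where 'a = 'a]
    by (intro integrable_mult_right integrableI_nonneg) auto
  show "AE z::'a in lborel. norm (exp (- (norm z)\<^sup>2 / 2)) \<le> norm (exp (1 / 2) * exp (- 1 * norm z))"
  proof (rule AE_I2)
    fix z :: 'a
    \<comment> \<open>Completing the square compares the Gaussian with an exponential already known
      to be integrable.\<close>
    have "0 \<le> (norm z - 1)\<^sup>2" by simp
    then have "- (norm z)\<^sup>2 / 2 \<le> 1 / 2 + - 1 * norm z" by (simp add: power2_eq_square algebra_simps)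
    then show "norm (exp (- (norm z)\<^sup>2 / 2)) \<le> norm (exp (1 / 2) * exp (- 1 * norm z))"
      by (simp flip: exp_add)
  qed
qed measurable

text \<open>Gaussian averages of a test function pair to zero with u, by Fubini and the preceding
  lemma; shrinking the width recovers \<phi> up to the positive constant \<open>?C\<close>.
  Smoothing \<phi> and not u keeps the limit elementary: \<phi> is bounded and continuous, and |u|
  dominates up to a constant.\<close>

lemma ftrans_zero_imp_AE_zero:
  fixes u :: "real^'n::finite \<Rightarrow> real"
  assumes u: "integrable lborel u" and zero: "\<And>\<xi>. ftrans (\<lambda>x. complex_of_real (u x)) \<xi> = 0"
  shows "AE x in lborel. u x = 0"
proof (rule fundamental_lemma)
  have [measurable]: "u \<in> borel_measurable borel" using u by auto
  show "loc_int u" unfolding loc_int_def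
    using integrable_mult_indicator[OF _ u, of "cball 0 _"] by simp
  fix \<phi> :: "real^'n \<Rightarrow> real" assume \<phi>: "test_function \<phi>"
  note [measurable] = test_function_measurable(1)[OF \<phi>]
  obtain B R where BR: "\<And>x. \<bar>\<phi> x\<bar> \<le> B" "\<And>x. norm x > R \<Longrightarrow> \<phi> x = 0"
    using test_function_bounded[OF \<phi>] by metis
  have B: "B \<ge> 0" using order_trans[OF abs_ge_zero BR(1)] .
  let ?\<gamma> = "\<lambda>z::real^'n. exp (- (norm z)\<^sup>2 / 2)"
  let ?C = "LINT z|lborel. ?\<gamma> z"
  \<comment> \<open>The Gaussian average of \<phi> after the substitution y = x + s z, so that the
    width s appears only in the argument of \<phi>. It is left unnormalised, hence the factor
    \<open>?C\<close> in the limit.\<close>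
  define P where "P s x = (LINT z|lborel. \<phi> (x + s *\<^sub>R z) * ?\<gamma> z)" for s x
  have [measurable]: "P s \<in> borel_measurable borel" for s unfolding P_def by measurable
  have P_bound: "\<bar>P s x\<bar> \<le> B * ?C" for s x
  proof -
    have "norm (P s x) \<le> (LINT z|lborel. B * ?\<gamma> z)"
      unfolding P_def
    proof (rule Bochner_Integration.integral_norm_bound_integral)
      show i: "integrable lborel (\<lambda>z. B * ?\<gamma> z)" using integrable_exp_norm_square[where 'a = "real^'n"] by simp
      show b: "norm (\<phi> (x + s *\<^sub>R z) * ?\<gamma> z) \<le> B * ?\<gamma> z" for z
        using BR(1) by (auto simp: abs_mult intro!: mult_right_mono)
      show "integrable lborel (\<lambda>z. \<phi> (x + s *\<^sub>R z) * ?\<gamma> z)"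
        by (rule Bochner_Integration.integrable_bound[OF i]) (measurable, use b B in \<open>auto simp: abs_mult\<close>)
    qed
    then show ?thesis by simp
  qed
  have uP: "(LINT x|lborel. u x * P s x) = 0" if "s > 0" for s
  proof -
    let ?k = "\<lambda>x y. exp (- (norm ((1 / s) *\<^sub>R (x - y)))\<^sup>2 / 2)"
    have k0: "(LINT x|lborel. u x * ?k x y) = 0" for y
    proof -
      have "complex_of_real (LINT x|lborel. u x * ?k x y) = (LINT x|lborel. complex_of_real (u x * ?k x y))"
        by (rule integral_complex_of_real[symmetric])
      also have "\<dots> = (LINT x|lborel. complex_of_real (u x) * exp (- (norm ((1 / s) *\<^sub>R (x - y)))\<^sup>2 / 2))"
        by (simp flip: exp_of_real)
      also have "\<dots> = 0"
        using ftrans_zero_gauss_convolution[of "\<lambda>x. complex_of_real (u x)" "1 / s" y] u zero by simp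
      finally show ?thesis by simp
    qed
    have "(LINT y|lborel. \<phi> y * ?k x y) = s ^ CARD('n) * P s x" for x
    proof -
      have "(LINT y|lborel. \<phi> y * ?k x y) = \<bar>s\<bar> ^ DIM(real^'n) *\<^sub>R (LINT z|lborel. \<phi> (x + s *\<^sub>R z) * ?k x (x + s *\<^sub>R z))"
        by (rule lborel_integral_scale) (use that in auto)
      then show ?thesis using that by (simp add: P_def)
    qed
    then have "(LINT x|lborel. u x * (LINT y|lborel. \<phi> y * ?k x y)) = (LINT x|lborel. s ^ CARD('n) * (u x * P s x))"
      by (intro Bochner_Integration.integral_cong) (simp_all only: mult.left_commute)
    then have "s ^ CARD('n) * (LINT x|lborel. u x * P s x) = (LINT x|lborel. u x * (LINT y|lborel. \<phi> y * ?k x y))"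
      by simp
    also have "\<dots> = (LINT x|lborel. LINT y|lborel. u x * (\<phi> y * ?k x y))" by simp
    also have "\<dots> = (LINT y|lborel. LINT x|lborel. u x * (\<phi> y * ?k x y))"
    proof (rule lborel_pair.Fubini_integral[symmetric])
      have "integrable (lborel \<Otimes>\<^sub>M lborel) (\<lambda>(x, y). u x * \<phi> y)"
        using u test_function_integrable[OF \<phi>] by (intro lborel_pair.Fubini_integrable) (auto simp: abs_mult)
      then show "integrable (lborel \<Otimes>\<^sub>M lborel) (\<lambda>(x, y). u x * (\<phi> y * ?k x y))"
      proof (rule Bochner_Integration.integrable_bound)
        show "AE z in lborel \<Otimes>\<^sub>M lborel. norm (case z of (x, y) \<Rightarrow> u x * (\<phi> y * ?k x y)) \<le> norm (case z of (x, y) \<Rightarrow> u x * \<phi> y)"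
          by (rule AE_I2) (auto simp: abs_mult intro!: mult_left_mono mult_left_le)
      qed measurable
    qed
    also have "\<dots> = (LINT y|lborel. \<phi> y * (LINT x|lborel. u x * ?k x y))"
      by (subst integral_mult_right_zero[symmetric]) (simp add: mult_ac)
    also have "\<dots> = (LINT y|lborel. \<phi> y * 0)" by (simp only: k0)
    also have "\<dots> = 0" by simp
    finally show ?thesis using that by simp
  qed
  have "(\<lambda>n. LINT x|lborel. u x * P (1 / real (Suc n)) x) \<longlonglongrightarrow> (LINT x|lborel. u x * (\<phi> x * ?C))"
  proof (rule integral_dominated_convergence)
    show "integrable lborel (\<lambda>x. \<bar>u x\<bar> * (B * ?C))" using u by simp
    show "AE x in lborel. norm (u x * P (1 / real (Suc n)) x) \<le> \<bar>u x\<bar> * (B * ?C)" for n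
      using P_bound by (intro AE_I2) (auto simp: abs_mult intro!: mult_left_mono)
    show "AE x in lborel. (\<lambda>n. u x * P (1 / real (Suc n)) x) \<longlonglongrightarrow> u x * (\<phi> x * ?C)"
    proof (rule AE_I2, rule tendsto_mult[OF tendsto_const])
      fix x
      have "(\<lambda>n. LINT z|lborel. \<phi> (x + (1 / real (Suc n)) *\<^sub>R z) * ?\<gamma> z) \<longlonglongrightarrow> (LINT z|lborel. \<phi> x * ?\<gamma> z)"
      proof (rule integral_dominated_convergence)
        show "integrable lborel (\<lambda>z. B * ?\<gamma> z)" using integrable_exp_norm_square[where 'a = "real^'n"] by simp
        show "AE z in lborel. (\<lambda>n. \<phi> (x + (1 / real (Suc n)) *\<^sub>R z) * ?\<gamma> z) \<longlonglongrightarrow> \<phi> x * ?\<gamma> z"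
        proof (rule AE_I2, rule tendsto_mult[OF _ tendsto_const])
          fix z
          have "(\<lambda>n. x + (1 / real (Suc n)) *\<^sub>R z) \<longlonglongrightarrow> x + 0 *\<^sub>R z"
            by (intro tendsto_intros LIMSEQ_Suc[OF lim_1_over_n])
          then show "(\<lambda>n. \<phi> (x + (1 / real (Suc n)) *\<^sub>R z)) \<longlonglongrightarrow> \<phi> x"
            using continuous_on_tendsto_compose[OF test_function_continuous[OF \<phi>]] by auto
        qed
        show "AE z in lborel. norm (\<phi> (x + (1 / real (Suc n)) *\<^sub>R z) * ?\<gamma> z) \<le> B * ?\<gamma> z" for n
          using BR(1) by (intro AE_I2) (auto simp: abs_mult intro!: mult_right_mono)
      qed measurable
      then show "(\<lambda>n. P (1 / real (Suc n)) x) \<longlonglongrightarrow> \<phi> x * ?C" by (simp add: P_def)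
    qed
  qed measurable
  then have "(LINT x|lborel. u x * (\<phi> x * ?C)) = 0"
    using uP by (simp add: LIMSEQ_const_iff)
  moreover have "?C \<noteq> 0"
  proof
    assume "?C = 0"
    then have "AE z::real^'n in lborel. ?\<gamma> z = 0"
      using integrable_exp_norm_square[where 'a = "real^'n"] by (subst (asm) integral_nonneg_eq_0_iff_AE) auto
    then have "AE z::real^'n in lborel. False" by simp
    then have "(UNIV :: (real^'n) set) \<in> null_sets lborel" by (subst AE_iff_null_sets) auto
    then show False by (simp add: null_sets_def)
  qed
  ultimately show "(LINT x|lborel. u x * \<phi> x) = 0" by (simp add: mult.assoc[symmetric])
qed

section \<open>From the half-Laplacian to the Fourier side\<close>

lemma lebesgue_borel_representative:
  fixes f :: "'a::euclidean_space \<Rightarrow> real"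
  assumes "f \<in> borel_measurable lebesgue"
  obtains f' where "f' \<in> borel_measurable borel" "AE x in lborel. f x = f' x"
  using completion_ex_borel_measurable_real[OF assms] by auto

text \<open>Completeness of Lebesgue measure: preimages under f and g differ by a null set. It
  supplies measurability of the half-Laplacian from the equation.\<close>

lemma measurable_lebesgue_cong_AE:
  assumes f: "f \<in> measurable lebesgue N" and "AE x in lborel. f x = g x" "space N = UNIV"
  shows "g \<in> measurable lebesgue N"
proof (rule measurableI)
  fix S assume "S \<in> sets N"
  then have A: "f -` S \<inter> space lebesgue \<in> sets lebesgue" by (rule measurable_sets[OF f])
  have "AE x in lebesgue. x \<in> f -` S \<inter> space lebesgue \<longleftrightarrow> x \<in> g -` S \<inter> space lebesgue"
    using AE_completion[OF assms(2)] by eventually_elim simp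
  then show "g -` S \<inter> space lebesgue \<in> sets lebesgue"
    by (rule completion.in_sets_AE[OF _ A]) simp
qed (simp add: assms)

lemma locally_integrable_borel_measurable:
  fixes f :: "real^'n::finite \<Rightarrow> real"
  assumes "locally_integrable f"
  shows "f \<in> borel_measurable lebesgue"
proof (rule borel_measurable_LIMSEQ_real)
  show "(\<lambda>x. indicator (cball 0 (real n)) x *\<^sub>R f x) \<in> borel_measurable lebesgue" for n
    using assms unfolding locally_integrable_def set_integrable_def by (auto intro!: borel_measurable_integrable)
  fix x :: "real^'n"
  have "\<forall>\<^sub>F n in sequentially. indicator (cball 0 (real n)) x *\<^sub>R f x = f x"
    using eventually_ge_at_top[of "nat \<lceil>norm x\<rceil>"] by eventually_elim (auto simp: indicator_def nat_ceiling_le_eq)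
  then show "(\<lambda>n. indicator (cball 0 (real n)) x *\<^sub>R f x) \<longlonglongrightarrow> f x"
    by (rule tendsto_eventually)
qed

lemma locally_integrable_component:
  fixes G :: "real^'n::finite \<Rightarrow> real^'m::finite"
  assumes "locally_integrable G"
  shows "locally_integrable (\<lambda>x. G x $ i)"
  using assms absolutely_integrable_linear[OF _ bounded_linear_vec_nth[of i]]
  unfolding locally_integrable_def by (auto simp: o_def)

lemma locally_integrable_imp_loc_int:
  fixes f :: "real^'n::finite \<Rightarrow> real"
  assumes f: "locally_integrable f" and [measurable]: "f' \<in> borel_measurable borel"
    and ae: "AE x in lborel. f x = f' x"
  shows "loc_int f'"
proof -
  have "integrable lborel (\<lambda>x. indicator (cball 0 R) x * f' x)" for R
  proof -
    have i: "integrable lebesgue (\<lambda>x. indicator (cball 0 R) x * f x)"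
      using f unfolding locally_integrable_def set_integrable_def by simp
    have m: "(\<lambda>x. indicator (cball 0 R) x * f' x) \<in> borel_measurable lborel" by measurable
    have "integrable lebesgue (\<lambda>x. indicator (cball 0 R) x * f' x)"
      by (rule integrable_cong_AE_imp[OF i measurable_completion[OF m]])
         (use AE_completion[OF ae] in eventually_elim, simp)
    then show ?thesis using m by (simp add: integrable_completion)
  qed
  then show ?thesis by (simp add: loc_int_def)
qed

text \<open>Carries the Lebesgue-measure notion of the statement over to the Borel setting; the
  change of representatives alters the integrands only on null sets.\<close>

lemma has_weak_gradient_imp_weak_pd:
  fixes u :: "real^'n::finite \<Rightarrow> real" and G :: "real^'n \<Rightarrow> real^'n"
  assumes uG: "has_weak_gradient u G"
    and u'[measurable]: "u' \<in> borel_measurable borel" and ae: "AE x in lborel. u x = u' x"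
    and w[measurable]: "w \<in> borel_measurable borel" and aew: "AE x in lborel. G x $ i = w x"
  shows "weak_pd i u' w"
proof -
  have u: "locally_integrable u" and G: "locally_integrable (\<lambda>x. G x $ i)"
    using uG locally_integrable_component by (auto simp: has_weak_gradient_def)
  have l: "loc_int u'" "loc_int w"
    using u G by (auto intro: locally_integrable_imp_loc_int ae aew)
  have "(LINT x|lborel. u' x * partial_deriv i \<phi> x) = - (LINT x|lborel. w x * \<phi> x)"
    if \<phi>: "test_function \<phi>" for \<phi>
  proof -
    note [measurable] = test_function_measurable[OF \<phi>]
    have m: "(\<lambda>x. u' x * partial_deriv i \<phi> x) \<in> borel_measurable lborel" "(\<lambda>x. w x * \<phi> x) \<in> borel_measurable lborel"
      by measurable
    have "(LINT x|lborel. u' x * partial_deriv i \<phi> x) = (LINT x|lebesgue. u' x * partial_deriv i \<phi> x)"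
      using m by (simp add: integral_completion)
    also have "\<dots> = (LINT x|lebesgue. u x * partial_deriv i \<phi> x)"
      using AE_completion[OF ae] locally_integrable_borel_measurable[OF u] measurable_completion[OF m(1)]
        measurable_completion[of "partial_deriv i \<phi>" lborel borel]
      by (intro integral_cong_AE) auto
    also have "\<dots> = - (LINT x|lebesgue. G x $ i * \<phi> x)"
      using uG \<phi> by (simp add: has_weak_gradient_def)
    also have "(LINT x|lebesgue. G x $ i * \<phi> x) = (LINT x|lebesgue. w x * \<phi> x)"
      using AE_completion[OF aew] locally_integrable_borel_measurable[OF G] measurable_completion[OF m(2)]
        measurable_completion[of "\<phi>" lborel borel]
      by (intro integral_cong_AE) auto
    also have "\<dots> = (LINT x|lborel. w x * \<phi> x)"
      using m by (simp add: integral_completion)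
    finally show ?thesis .
  qed
  with l show ?thesis by (simp add: weak_pd_def)
qed

lemma continuous_AE_zero:
  fixes f :: "'a::euclidean_space \<Rightarrow> 'b::real_normed_vector"
  assumes f: "continuous_on UNIV f" and ae: "AE x in lborel. f x = 0"
  shows "f x = 0"
proof -
  have "open {x. f x \<noteq> 0}" using f by (intro open_Collect_neq) auto
  moreover have "negligible {x. f x \<noteq> 0}"
    using AE_completion[OF ae] by (simp add: negligible_iff_null_sets AE_iff_null_sets borel_open calculation)
  ultimately show ?thesis using open_not_negligible by blast
qed

text \<open>Test functions are real, so real and imaginary parts are tested separately. Continuity
  upgrades the result to every point, since a nonempty open set is not negligible.\<close>

lemma continuous_fundamental_lemma:
  fixes F :: "real^'n::finite \<Rightarrow> complex"
  assumes F: "continuous_on UNIV F"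
    and zero: "\<And>\<phi>. test_function \<phi> \<Longrightarrow> (LINT x|lborel. F x * complex_of_real (\<phi> x)) = 0"
  shows "F x = 0"
proof -
  have c: "continuous_on UNIV (\<lambda>x. Re (F x))" "continuous_on UNIV (\<lambda>x. Im (F x))"
    using F by (auto intro: continuous_intros)
  note l = c[THEN continuous_imp_loc_int]
  have "(LINT x|lborel. Re (F x) * \<phi> x) = 0 \<and> (LINT x|lborel. Im (F x) * \<phi> x) = 0"
    if \<phi>: "test_function \<phi>" for \<phi>
  proof -
    have "integrable lborel (\<lambda>x. F x * complex_of_real (\<phi> x))"
    proof -
      have "integrable lborel (\<lambda>x. complex_of_real (Re (F x) * \<phi> x) + \<i> * complex_of_real (Im (F x) * \<phi> x))"
        by (intro Bochner_Integration.integrable_add integrable_mult_right integrable_of_real l[THEN loc_int_test_integrable(1)[OF _ \<phi>]])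
      also have "(\<lambda>x. complex_of_real (Re (F x) * \<phi> x) + \<i> * complex_of_real (Im (F x) * \<phi> x)) = (\<lambda>x. F x * complex_of_real (\<phi> x))"
        by (auto simp: complex_eq_iff)
      finally show ?thesis .
    qed
    from integral_Re[OF this] integral_Im[OF this] zero[OF \<phi>] show ?thesis by simp
  qed
  then have "AE x in lborel. Re (F x) = 0" "AE x in lborel. Im (F x) = 0"
    using l by (auto intro: fundamental_lemma)
  then have "AE x in lborel. F x = 0" by eventually_elim (simp add: complex_eq_iff)
  with F show ?thesis by (rule continuous_AE_zero)
qed

text \<open>Integrability of both functions turns the distributional relation into a pointwise one:
  duality moves the transforms from the test functions to g and u', whose transforms are continuous,
  so testing determines them everywhere.\<close>

lemma half_laplacian_ftrans:
  fixes u :: "real^'n::finite \<Rightarrow> real"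
  assumes hl: "is_half_laplacian u Hu"
    and u': "integrable lborel u'" "AE x in lborel. u x = u' x" and um: "u \<in> borel_measurable lebesgue"
    and g: "integrable lborel g" "AE x in lborel. Hu x = g x" and Hm: "Hu \<in> borel_measurable lebesgue"
  shows "ftrans (\<lambda>x. complex_of_real (g x)) \<xi> = of_real (norm \<xi>) * ftrans (\<lambda>x. complex_of_real (u' x)) \<xi>"
proof -
  let ?u = "\<lambda>x. complex_of_real (u' x)" and ?g = "\<lambda>x. complex_of_real (g x)"
  have [measurable]: "u' \<in> borel_measurable borel" "g \<in> borel_measurable borel" using u' g by auto
  have ui: "integrable lborel ?u" and gi: "integrable lborel ?g" using u' g by auto
  have "ftrans ?g \<xi> - of_real (norm \<xi>) * ftrans ?u \<xi> = 0"
  proof (rule continuous_fundamental_lemma[where F = "\<lambda>\<xi>. ftrans ?g \<xi> - of_real (norm \<xi>) * ftrans ?u \<xi>"])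
    show "continuous_on UNIV (\<lambda>\<xi>. ftrans ?g \<xi> - of_real (norm \<xi>) * ftrans ?u \<xi>)"
      by (intro continuous_intros continuous_on_ftrans ui gi)
    fix \<phi> :: "real^'n \<Rightarrow> real" assume \<phi>: "test_function \<phi>"
    note [measurable] = test_function_measurable(1)[OF \<phi>]
    \<comment> \<open>\<open>?\<psi>\<close> need not be smooth at the origin, but duality asks only
      for integrability.\<close>
    let ?\<phi> = "\<lambda>x. complex_of_real (\<phi> x)" and ?\<psi> = "\<lambda>\<xi>. norm \<xi> *\<^sub>R complex_of_real (\<phi> \<xi>)"
    have \<phi>i: "integrable lborel ?\<phi>"
      using test_function_integrable[OF \<phi>] by simp
    have "integrable lborel (\<lambda>x. norm x * \<phi> x)"
      by (rule loc_int_test_integrable(1)[OF continuous_imp_loc_int \<phi>]) (intro continuous_intros)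
    then have "integrable lborel (\<lambda>x. complex_of_real (norm x * \<phi> x))" by (rule integrable_of_real)
    then have \<psi>i: "integrable lborel ?\<psi>" by (simp add: scaleR_conv_of_real)
    have F: "fourier ?\<phi> = ftrans ?\<phi>" "fourier ?\<psi> = ftrans ?\<psi>"
      by (intro fourier_eq_ftrans; measurable)+
    have [measurable]: "ftrans ?\<phi> \<in> borel_measurable borel" "ftrans ?\<psi> \<in> borel_measurable borel"
      by (intro borel_measurable_continuous_onI continuous_on_ftrans \<phi>i \<psi>i)+
    have m: "(\<lambda>x. ?g x * ftrans ?\<phi> x) \<in> borel_measurable lborel" "(\<lambda>x. ?u x * ftrans ?\<psi> x) \<in> borel_measurable lborel"
      by measurable
    have "(LINT x|lborel. ?g x * ftrans ?\<phi> x) = (LINT x|lebesgue. ?g x * ftrans ?\<phi> x)"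
      using m by (simp add: integral_completion)
    also have "\<dots> = (LINT x|lebesgue. Hu x *\<^sub>R ftrans ?\<phi> x)"
    proof (rule integral_cong_AE)
      show "(\<lambda>x. ?g x * ftrans ?\<phi> x) \<in> borel_measurable lebesgue" by (rule measurable_completion) (rule m)
      show "(\<lambda>x. Hu x *\<^sub>R ftrans ?\<phi> x) \<in> borel_measurable lebesgue"
        by (intro borel_measurable_scaleR Hm measurable_completion) measurable
      show "AE x in lebesgue. ?g x * ftrans ?\<phi> x = Hu x *\<^sub>R ftrans ?\<phi> x"
        using AE_completion[OF g(2)] by eventually_elim (simp add: scaleR_conv_of_real)
    qed
    also have "\<dots> = (LINT x|lebesgue. u x *\<^sub>R ftrans ?\<psi> x)"
    proof -
      have "(LINT x|lebesgue. Hu x *\<^sub>R fourier ?\<phi> x) = (LINT x|lebesgue. u x *\<^sub>R fourier ?\<psi> x)"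
        using hl schwartz_of_real_test_function[OF \<phi>] unfolding is_half_laplacian_def fourier_multiplier_def by blast
      then show ?thesis by (simp only: F)
    qed
    also have "\<dots> = (LINT x|lebesgue. ?u x * ftrans ?\<psi> x)"
    proof (rule integral_cong_AE)
      show "(\<lambda>x. u x *\<^sub>R ftrans ?\<psi> x) \<in> borel_measurable lebesgue"
        by (intro borel_measurable_scaleR um measurable_completion) measurable
      show "(\<lambda>x. ?u x * ftrans ?\<psi> x) \<in> borel_measurable lebesgue" by (rule measurable_completion) (rule m)
      show "AE x in lebesgue. u x *\<^sub>R ftrans ?\<psi> x = ?u x * ftrans ?\<psi> x"
        using AE_completion[OF u'(2)] by eventually_elim (simp add: scaleR_conv_of_real)
    qed
    also have "\<dots> = (LINT x|lborel. ?u x * ftrans ?\<psi> x)"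
      using m by (simp add: integral_completion)
    finally have "(LINT x|lborel. ?g x * ftrans ?\<phi> x) = (LINT x|lborel. ?u x * ftrans ?\<psi> x)" .
    then have eq: "(LINT x|lborel. ftrans ?g x * ?\<phi> x) = (LINT x|lborel. ftrans ?u x * ?\<psi> x)"
      using ftrans_duality[OF gi \<phi>i, of 1] ftrans_duality[OF ui \<psi>i, of 1] by simp
    have bdd: "integrable lborel (\<lambda>x. ftrans f x * h x)" if f: "integrable lborel f" and h: "integrable lborel h" for f h :: "real^'n \<Rightarrow> complex"
    proof (rule Bochner_Integration.integrable_bound)
      show "integrable lborel (\<lambda>x. (LINT y|lborel. norm (f y)) *\<^sub>R h x)" using h by simp
      have "ftrans f \<in> borel_measurable borel"
        by (intro borel_measurable_continuous_onI continuous_on_ftrans f)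
      then show "(\<lambda>x. ftrans f x * h x) \<in> borel_measurable lborel" using h by simp
      have "norm (ftrans f x) \<le> (LINT y|lborel. norm (f y))" for x
        unfolding ftrans_def using integral_norm_bound[of lborel "\<lambda>y. exp (- \<i> * complex_of_real (y \<bullet> x)) * f y"]
        by (simp add: norm_mult)
      then show "AE x in lborel. norm (ftrans f x * h x) \<le> norm ((LINT y|lborel. norm (f y)) *\<^sub>R h x)"
        by (intro AE_I2) (auto simp: norm_mult intro!: mult_right_mono)
    qed
    show "(LINT x|lborel. (ftrans ?g x - of_real (norm x) * ftrans ?u x) * ?\<phi> x) = 0"
    proof -
      have "(LINT x|lborel. (ftrans ?g x - of_real (norm x) * ftrans ?u x) * ?\<phi> x)
        = (LINT x|lborel. ftrans ?g x * ?\<phi> x - ftrans ?u x * ?\<psi> x)"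
        by (simp add: algebra_simps scaleR_conv_of_real)
      also have "\<dots> = 0" using bdd[OF gi \<phi>i] bdd[OF ui \<psi>i] eq by simp
      finally show ?thesis .
    qed
  qed
  then show ?thesis by simp
qed

section \<open>Essential bounds and the uniqueness argument\<close>

lemma Linf_norm_nonneg: "0 \<le> Linf_norm (f :: real^'n::finite \<Rightarrow> 'b::real_normed_vector)"
proof -
  have "0 = esssup lebesgue (\<lambda>x::real^'n. 0 :: ereal)"
    by (rule esssup_const[symmetric]) simp
  also have "\<dots> \<le> Linf_norm f" unfolding Linf_norm_def by (rule esssup_mono) auto
  finally show ?thesis .
qed

lemma Linf_norm_leD:
  assumes "Linf_norm f \<le> ereal c"
  shows "AE x in lborel. norm (f x) \<le> c"
proof -
  have "AE x in lebesgue. ereal (norm (f x)) \<le> Linf_norm f"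
    unfolding Linf_norm_def by (rule esssup_AE)
  then show ?thesis unfolding AE_completion_iff
  proof eventually_elim
    case (elim x)
    then have "ereal (norm (f x)) \<le> ereal c" using assms by (rule order_trans)
    then show ?case by simp
  qed
qed

text \<open>The a.e. bounds on b and q pass the exponential integrability of u and its gradient on
  to the half-Laplacian, so that both functions meet the hypotheses of
  \<open>ftrans_norm_multiple_zero\<close> with the same rate d.\<close>

lemma landis_half_laplacian:
  fixes b :: "real^'n::finite \<Rightarrow> real^'n" and q u :: "real^'n \<Rightarrow> real"
  assumes b: "\<And>i. (\<lambda>x. b x $ i) \<in> borel_measurable lebesgue" "AE x in lborel. norm (b x) \<le> M"
    and q: "q \<in> borel_measurable lebesgue" "AE x in lborel. \<bar>q x\<bar> \<le> L"
    and sob: "in_sobolev 2 p u" and "p \<ge> 1" and Du: "has_weak_gradient u Du" and hl: "is_half_laplacian u Hu"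
    and eq: "AE x in lebesgue. Hu x + b x \<bullet> Du x + q x * u x = 0"
    and "lam > 0" and u: "\<And>x. \<bar>u x\<bar> \<le> L * exp (- lam * norm x)"
  shows "AE x in lebesgue. u x = 0"
proof -
  \<comment> \<open>Matches the rate 8d demanded by
    \<open>weak_pd_exponential_decay\<close>.\<close>
  define d where "d = lam / 8"
  have d: "d > 0" "lam = 8 * d" using \<open>lam > 0\<close> by (auto simp: d_def)
  have L: "L \<ge> 0" using u[of 0] by simp
  have um: "u \<in> borel_measurable lebesgue" using sob by (simp add: numeral_2_eq_2 in_Lp_def)
  obtain u' where u'[measurable]: "u' \<in> borel_measurable borel" and uu': "AE x in lborel. u x = u' x"
    using lebesgue_borel_representative[OF um] .
  have Dum: "(\<lambda>x. Du x $ i) \<in> borel_measurable lebesgue" for i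
    using Du locally_integrable_component locally_integrable_borel_measurable unfolding has_weak_gradient_def by blast
  have "\<exists>D. D \<in> borel_measurable borel \<and> (AE x in lborel. Du x $ i = D x)" for i
    using completion_ex_borel_measurable_real[OF Dum[of i]] by auto
  then obtain D where D[measurable]: "\<And>i. D i \<in> borel_measurable borel"
    and DuD: "\<And>i. AE x in lborel. Du x $ i = D i x" by metis
  have u'_bound: "AE x in lborel. \<bar>u' x\<bar> \<le> L * exp (- (8 * d) * norm x)"
    using uu'
  proof eventually_elim
    case (elim x)
    then show ?case using u[of x] d(2) by simp
  qed
  \<comment> \<open>\<open>G\<close> is the gradient with second-order regularity. Its components
    are shown to decay, using the diagonal entry of their own gradients, and uniqueness carries the
    decay over to the given \<open>Du\<close>.\<close>
  obtain G :: "real^'n \<Rightarrow> real^'n" where G: "has_weak_gradient u G" "\<And>i. in_sobolev 1 p (\<lambda>x. G x $ i)"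
    using sob by (auto simp: numeral_2_eq_2)
  have D_int: "integrable lborel (\<lambda>x. exp (d * norm x) * \<bar>D i x\<bar>)" for i
  proof -
    have Gm: "(\<lambda>x. G x $ i) \<in> borel_measurable lebesgue" using G(2)[of i] by (simp add: in_Lp_def)
    obtain g where g[measurable]: "g \<in> borel_measurable borel" and Gg: "AE x in lborel. G x $ i = g x"
      using lebesgue_borel_representative[OF Gm] .
    obtain H :: "real^'n \<Rightarrow> real^'n" where H: "has_weak_gradient (\<lambda>x. G x $ i) H" "in_Lp p (\<lambda>x. H x $ i)"
      using G(2)[of i] by auto
    have Hm: "(\<lambda>x. H x $ i) \<in> borel_measurable lebesgue" using H(2) by (simp add: in_Lp_def)
    obtain h where h[measurable]: "h \<in> borel_measurable borel" and Hh: "AE x in lborel. H x $ i = h x"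
      using lebesgue_borel_representative[OF Hm] .
    have ug: "weak_pd i u' g" by (rule has_weak_gradient_imp_weak_pd[OF G(1) u' uu' g Gg])
    have gh: "weak_pd i g h" by (rule has_weak_gradient_imp_weak_pd[OF H(1) g Gg h Hh])
    have uD: "weak_pd i u' (D i)" by (rule has_weak_gradient_imp_weak_pd[OF Du u' uu' D DuD])
    have "integrable lebesgue (\<lambda>x. \<bar>h x\<bar> powr p)"
    proof (rule integrable_cong_AE_imp)
      show "integrable lebesgue (\<lambda>x. norm (H x $ i) powr p)" using H(2) by (simp add: in_Lp_def)
      show "AE x in lebesgue. norm (H x $ i) powr p = \<bar>h x\<bar> powr p"
        using AE_completion[OF Hh] by eventually_elim simp
      show "(\<lambda>x. \<bar>h x\<bar> powr p) \<in> borel_measurable lebesgue"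
        by (rule measurable_completion) measurable
    qed
    then have "integrable lborel (\<lambda>x. \<bar>h x\<bar> powr p)" by (subst (asm) integrable_completion) auto
    then have "(\<integral>\<^sup>+x. ennreal (\<bar>h x\<bar> powr p) \<partial>lborel) < \<infinity>" by (simp add: integrable_iff_bounded)
    then have "(\<integral>\<^sup>+x. ennreal (exp (d * norm x) * \<bar>g x\<bar>) \<partial>lborel) < \<infinity>"
      using weak_pd_exponential_decay[OF ug gh u'_bound _ \<open>p \<ge> 1\<close> d(1) L] by simp
    then have "integrable lborel (\<lambda>x. exp (d * norm x) * \<bar>g x\<bar>)"
      by (intro integrableI_nonneg) auto
    then show ?thesis
    proof (rule integrable_cong_AE_imp)
      show "AE x in lborel. exp (d * norm x) * \<bar>g x\<bar> = exp (d * norm x) * \<bar>D i x\<bar>"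
        using weak_pd_unique[OF ug uD] by auto
    qed measurable
  qed
  have u'_int: "integrable lborel (\<lambda>x. exp (d * norm x) * u' x)"
  proof (rule Bochner_Integration.integrable_bound)
    show "integrable lborel (\<lambda>x::real^'n. L * exp (- (7 * d) * norm x))"
      using nn_integral_exp_norm_finite[of "7 * d", where 'a = "real^'n"] d
      by (intro integrable_mult_right integrableI_nonneg) auto
    show "AE x in lborel. norm (exp (d * norm x) * u' x) \<le> norm (L * exp (- (7 * d) * norm x))"
      using u'_bound
    proof eventually_elim
      case (elim x)
      have "exp (d * norm x) * \<bar>u' x\<bar> \<le> exp (d * norm x) * (L * exp (- (8 * d) * norm x))"
        using elim by (intro mult_left_mono) auto
      also have "\<dots> = L * (exp (d * norm x) * exp (- (8 * d) * norm x))" by simp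
      also have "exp (d * norm x) * exp (- (8 * d) * norm x) = exp (- (7 * d) * norm x)"
        unfolding exp_add[symmetric] by simp
      finally show ?case using L by (simp add: abs_mult)
    qed
  qed measurable
  \<comment> \<open>The equation solved for the half-Laplacian; its Borel representative g takes the
    place of \<open>Hu\<close> from here on.\<close>
  have "(\<lambda>x. - (\<Sum>i\<in>UNIV. b x $ i * Du x $ i) - q x * u x) \<in> borel_measurable lebesgue"
    using b(1) Dum q(1) um by measurable
  then obtain g where g[measurable]: "g \<in> borel_measurable borel"
    and geq: "AE x in lborel. - (\<Sum>i\<in>UNIV. b x $ i * Du x $ i) - q x * u x = g x"
    by (rule lebesgue_borel_representative)
  have Hg: "AE x in lborel. Hu x = g x"
    using eq[unfolded AE_completion_iff] geq by eventually_elim (simp add: inner_vec_def algebra_simps)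
  have g_int: "integrable lborel (\<lambda>x. exp (d * norm x) * g x)"
  proof (rule Bochner_Integration.integrable_bound)
    show "integrable lborel (\<lambda>x. (\<Sum>i\<in>UNIV. M * (exp (d * norm x) * \<bar>D i x\<bar>)) + L * \<bar>exp (d * norm x) * u' x\<bar>)"
      using D_int u'_int by (intro Bochner_Integration.integrable_add Bochner_Integration.integrable_sum integrable_mult_right integrable_abs) auto
    have "AE x in lborel. \<forall>i\<in>UNIV. Du x $ i = D i x" by (subst AE_finite_all) (auto simp: DuD)
    then show "AE x in lborel. norm (exp (d * norm x) * g x)
        \<le> norm ((\<Sum>i\<in>UNIV. M * (exp (d * norm x) * \<bar>D i x\<bar>)) + L * \<bar>exp (d * norm x) * u' x\<bar>)"
      using geq b(2) q(2) uu'
    proof eventually_elim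
      case (elim x)
      have "\<bar>\<Sum>i\<in>UNIV. b x $ i * D i x\<bar> \<le> (\<Sum>i\<in>UNIV. M * \<bar>D i x\<bar>)"
      proof (rule order_trans[OF sum_abs sum_mono])
        fix i
        have "\<bar>b x $ i\<bar> \<le> M" using component_le_norm_cart[of "b x" i] elim by linarith
        then show "\<bar>b x $ i * D i x\<bar> \<le> M * \<bar>D i x\<bar>" by (simp add: abs_mult mult_right_mono)
      qed
      moreover have "\<bar>q x * u' x\<bar> \<le> L * \<bar>u' x\<bar>" using elim by (simp add: abs_mult mult_right_mono)
      moreover have "g x = - (\<Sum>i\<in>UNIV. b x $ i * D i x) - q x * u' x" using elim by simp
      ultimately have "\<bar>g x\<bar> \<le> (\<Sum>i\<in>UNIV. M * \<bar>D i x\<bar>) + L * \<bar>u' x\<bar>" by linarith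
      then have "exp (d * norm x) * \<bar>g x\<bar> \<le> exp (d * norm x) * ((\<Sum>i\<in>UNIV. M * \<bar>D i x\<bar>) + L * \<bar>u' x\<bar>)"
        by (intro mult_left_mono) auto
      also have "\<dots> = (\<Sum>i\<in>UNIV. M * (exp (d * norm x) * \<bar>D i x\<bar>)) + L * \<bar>exp (d * norm x) * u' x\<bar>"
        by (simp add: distrib_left sum_distrib_left abs_mult mult_ac)
      finally show ?case by (simp add: abs_mult)
    qed
  qed measurable
  have dom: "integrable lborel f" if "integrable lborel (\<lambda>x. exp (d * norm x) * f x)" "f \<in> borel_measurable borel" for f :: "real^'n \<Rightarrow> real"
  proof (rule Bochner_Integration.integrable_bound[OF that(1)])
    show "AE x in lborel. norm (f x) \<le> norm (exp (d * norm x) * f x)"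
      using d by (intro AE_I2) (simp add: abs_mult mult_le_cancel_right1)
  qed (use that in simp)
  have cint: "integrable lborel (\<lambda>x. exp (d * norm x) *\<^sub>R complex_of_real (f x))"
    if "integrable lborel (\<lambda>x. exp (d * norm x) * f x)" for f :: "real^'n \<Rightarrow> real"
    using integrable_of_real[OF that, where 'a = complex] by (simp add: scaleR_conv_of_real)
  \<comment> \<open>\<open>Hu\<close> is given through pairings; its measurability is inherited from
    g, with which it agrees almost everywhere.\<close>
  have Hm: "Hu \<in> borel_measurable lebesgue"
  proof (rule measurable_lebesgue_cong_AE)
    show "g \<in> borel_measurable lebesgue" by (rule measurable_completion) measurable
    show "AE x in lborel. g x = Hu x" using Hg by eventually_elim simp
  qed simp
  have "ftrans (\<lambda>x. complex_of_real (u' x)) \<xi> = 0" for \<xi>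
    by (rule ftrans_norm_multiple_zero[OF d(1) cint[OF u'_int] _ cint[OF g_int]])
       (measurable, rule half_laplacian_ftrans[OF hl dom[OF u'_int u'] uu' um dom[OF g_int g] Hg Hm])
  then have "AE x in lborel. u' x = 0" by (intro ftrans_zero_imp_AE_zero dom[OF u'_int u'])
  then show ?thesis unfolding AE_completion_iff using uu' by eventually_elim simp
qed

theorem theorem1p1:
  shows "\<exists>\<epsilon>::real. \<epsilon> > 0 \<and> (\<forall>(\<Lambda>::real) (b :: real^'n::finite \<Rightarrow> real^'n) (Db :: real^'n \<Rightarrow> real^'n^'n)
      (q :: real^'n \<Rightarrow> real) (Dq :: real^'n \<Rightarrow> real^'n)
      (p::nat) (u :: real^'n \<Rightarrow> real) (Du :: real^'n \<Rightarrow> real^'n) (Hu :: real^'n \<Rightarrow> real) (lam::real).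
    \<Lambda> > 0 \<longrightarrow>
    has_weak_jacobian b Db \<longrightarrow>
    has_weak_gradient q Dq \<longrightarrow>
    Linf_norm q + Linf_norm Dq + Linf_norm Db \<le> ereal \<Lambda> \<longrightarrow>
    Linf_norm b \<le> ereal \<epsilon> \<longrightarrow>
    p > CARD('n) \<longrightarrow>
    in_sobolev 2 (real p) u \<longrightarrow>
    has_weak_gradient u Du \<longrightarrow>
    is_half_laplacian u Hu \<longrightarrow>
    (AE x in lebesgue. Hu x + b x \<bullet> Du x + q x * u x = 0) \<longrightarrow>
    lam > 0 \<longrightarrow>
    (\<forall>x. \<bar>u x\<bar> \<le> \<Lambda> * exp (- lam * norm x)) \<longrightarrow>
    (AE x in lebesgue. u x = 0))"
proof (intro exI[of _ 1] conjI allI impI)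
  \<comment> \<open>The bound on b serves to make the drift term exponentially integrable, for which
    the value 1 is convenient.\<close>
  fix \<Lambda> :: real and b :: "real^'n \<Rightarrow> real^'n" and Db :: "real^'n \<Rightarrow> real^'n^'n" and q :: "real^'n \<Rightarrow> real"
    and Dq and p :: nat and u :: "real^'n \<Rightarrow> real" and Du :: "real^'n \<Rightarrow> real^'n" and Hu and lam :: real
  assume b: "has_weak_jacobian b Db" and q: "has_weak_gradient q Dq"
    and norms: "Linf_norm q + Linf_norm Dq + Linf_norm Db \<le> ereal \<Lambda>" and b1: "Linf_norm b \<le> ereal 1"
    and p: "p > CARD('n)"
    and rest: "in_sobolev 2 (real p) u" "has_weak_gradient u Du" "is_half_laplacian u Hu"
      "AE x in lebesgue. Hu x + b x \<bullet> Du x + q x * u x = 0" "lam > 0"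
      "\<forall>x. \<bar>u x\<bar> \<le> \<Lambda> * exp (- lam * norm x)"
  \<comment> \<open>The other two norms are nonnegative extended reals, so the bound on the sum
    passes to q.\<close>
  have "Linf_norm q + 0 + 0 \<le> Linf_norm q + Linf_norm Dq + Linf_norm Db"
    by (intro add_mono order_refl Linf_norm_nonneg)
  with norms have "Linf_norm q \<le> ereal \<Lambda>" by simp
  then have q_le: "AE x in lborel. \<bar>q x\<bar> \<le> \<Lambda>" using Linf_norm_leD by fastforce
  have bm: "(\<lambda>x. b x $ i) \<in> borel_measurable lebesgue" for i
    using b by (auto simp: has_weak_jacobian_def has_weak_gradient_def intro: locally_integrable_borel_measurable)
  have qm: "q \<in> borel_measurable lebesgue"
    using q by (auto simp: has_weak_gradient_def intro: locally_integrable_borel_measurable)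
  show "AE x in lebesgue. u x = 0"
    using landis_half_laplacian[OF bm Linf_norm_leD[OF b1] qm q_le rest(1) _ rest(2-5)] p rest(6) by simp
qed simp

end
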